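(* Let $E$ be a Hilbert module over a $C^*$-algebra and let $s=\{s_t\}_{t\ge 0}$ be a semigroup of isometries on $E$ (neither necessarily adjointable nor necessarily strongly continuous). Put $E_u:=\bigcap_{t\ge 0}s_tE$. Then: (1) $E_u$ is a closed submodule that is completely reducing for $s$ and that reduces $s$ to a semigroup of unitaries, and it is the unique maximal such submodule: every closed submodule $E'$ of $E$ that reduces $s$ to a semigroup of unitaries satisfies $E'\subset E_u$. (2) $E_u^\perp$ reduces $s$ to a completely nonunitary semigroup. (3) $E_u\oplus E_u^\perp$ need not be all of $E$: there exist a $C^*$-algebra $\mathcal{B}$, a Hilbert $\mathcal{B}$-module $E$ and a semigroup of isometries $s$ on $E$ such that $E_u\oplus E_u^\perp\neq E$.
   Context: A family $s=\{s_t\}_{t\ge 0}$ of linear maps on $E$ is a semigroup if $s_rs_t=s_{r+t}$ for all $r,t\ge 0$ and $s_0=\mathrm{id}$. A linear map $s$ on a Hilbert module is an isometry if $\langle sx,sy\rangle=\langle x,y\rangle$ for all $x,y$ (no adjoint is assumed to exist); a unitary is a surjective isometry. A subspace $W$ of $E$ reduces $s$ if $s_tW\subset W$ for all $t$; the semigroup reduced by $W$ is the (co)restriction of $s$ to $W$. Thus $W$ reduces $s$ to a semigroup of unitaries if and only if $s_tW=W$ for all $t$. For a closed submodule $F$ of $E$, $F^\perp:=\{x\in E:\langle y,x\rangle=0\ \text{for all } y\in F\}$; $F$ is completely reducing for $s$ if both $F$ and $F^\perp$ reduce $s$. Since $\langle F,F^\perp\rangle=\{0\}$, the sum $F+F^\perp$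 is identified with the direct sum $F\oplus F^\perp$. A semigroup of isometries is completely nonunitary if the only subspace $W$ with $s_tW=W$ for all $t$ is $W=\{0\}$. *)

theory Defs
  imports "HOL-Analysis.Analysis" "HOL-Algebra.Algebraic_Closure_Type"
begin

text \<open>
  Algebras and modules are records with an explicit carrier, extending the module record of
  HOL-Algebra. Complex vector spaces are modules over the ring \<open>complex_ring\<close>. Nothing is required
  of the inherited fields that have no meaning: \<open>one\<close> for C*-algebras (which need not be unital),
  \<open>mult\<close> and \<open>one\<close> for Hilbert modules.
\<close>

abbreviation complex_ring :: "complex ring"
  where "complex_ring \<equiv> ring_of_type_algebra"

abbreviation subspace_of :: "'a set \<Rightarrow> (complex, 'a, 'm) module_scheme \<Rightarrow> bool"
  where "subspace_of W M \<equiv> submodule W complex_ring M"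


section \<open>Banach spaces and C*-algebras\<close>

text \<open>The value off the carrier is irrelevant; 0 is chosen because the locale \<open>Metric_space\<close> asks
  for nonnegativity and symmetry on the whole type.\<close>

definition norm_dist :: "(complex, 'a, 'm) module_scheme \<Rightarrow> ('a \<Rightarrow> real) \<Rightarrow> 'a \<Rightarrow> 'a \<Rightarrow> real"
  where "norm_dist M N x y =
    (if x \<in> carrier M \<and> y \<in> carrier M then N (x \<ominus>\<^bsub>M\<^esub> y) else 0)"

locale complex_banach_space = Module.module complex_ring M
  for M :: "(complex, 'a, 'm) module_scheme" (structure) and N :: "'a \<Rightarrow> real" +
  assumes norm_nonneg: "x \<in> carrier M \<Longrightarrow> 0 \<le> N x"
    and norm_eq_zero_iff: "x \<in> carrier M \<Longrightarrow> N x = 0 \<longleftrightarrow> x = \<zero>\<^bsub>M\<^esub>"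
    and norm_smult: "x \<in> carrier M \<Longrightarrow> N (c \<odot>\<^bsub>M\<^esub> x) = cmod c * N x"
    and norm_triangle: "x \<in> carrier M \<Longrightarrow> y \<in> carrier M \<Longrightarrow> N (x \<oplus>\<^bsub>M\<^esub> y) \<le> N x + N y"
    and complete: "Metric_space.mcomplete (carrier M) (norm_dist M N)"

record 'b cstar = "(complex, 'b) module" +
  adj :: "'b \<Rightarrow> 'b"
  cnorm :: "'b \<Rightarrow> real"

locale cstar_algebra = complex_banach_space B "cnorm B" for B :: "'b cstar" (structure) +
  assumes mult_closed: "\<lbrakk>a \<in> carrier B; b \<in> carrier B\<rbrakk> \<Longrightarrow> a \<otimes> b \<in> carrier B"
    and mult_assoc: "\<lbrakk>a \<in> carrier B; b \<in> carrier B; c \<in> carrier B\<rbrakk>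
      \<Longrightarrow> (a \<otimes> b) \<otimes> c = a \<otimes> (b \<otimes> c)"
    and mult_distrib_right: "\<lbrakk>a \<in> carrier B; b \<in> carrier B; c \<in> carrier B\<rbrakk>
      \<Longrightarrow> (a \<oplus> b) \<otimes> c = a \<otimes> c \<oplus> b \<otimes> c"
    and mult_distrib_left: "\<lbrakk>a \<in> carrier B; b \<in> carrier B; c \<in> carrier B\<rbrakk>
      \<Longrightarrow> a \<otimes> (b \<oplus> c) = a \<otimes> b \<oplus> a \<otimes> c"
    and mult_smult_left: "\<lbrakk>a \<in> carrier B; b \<in> carrier B\<rbrakk>
      \<Longrightarrow> (z \<odot> a) \<otimes> b = z \<odot> (a \<otimes> b)"
    and mult_smult_right: "\<lbrakk>a \<in> carrier B; b \<in> carrier B\<rbrakk>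
      \<Longrightarrow> a \<otimes> (z \<odot> b) = z \<odot> (a \<otimes> b)"
    and adj_closed: "a \<in> carrier B \<Longrightarrow> adj B a \<in> carrier B"
    and adj_add: "\<lbrakk>a \<in> carrier B; b \<in> carrier B\<rbrakk>
      \<Longrightarrow> adj B (a \<oplus> b) = adj B a \<oplus> adj B b"
    and adj_smult: "a \<in> carrier B \<Longrightarrow> adj B (z \<odot> a) = cnj z \<odot> adj B a"
    and adj_mult: "\<lbrakk>a \<in> carrier B; b \<in> carrier B\<rbrakk>
      \<Longrightarrow> adj B (a \<otimes> b) = adj B b \<otimes> adj B a"
    and adj_adj: "a \<in> carrier B \<Longrightarrow> adj B (adj B a) = a"
    and cnorm_mult: "\<lbrakk>a \<in> carrier B; b \<in> carrier B\<rbrakk>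
      \<Longrightarrow> cnorm B (a \<otimes> b) \<le> cnorm B a * cnorm B b"
    and cnorm_adj_mult: "a \<in> carrier B \<Longrightarrow> cnorm B (adj B a \<otimes> a) = (cnorm B a)\<^sup>2"

definition positive_in :: "'b cstar \<Rightarrow> 'b \<Rightarrow> bool"
  where "positive_in B a \<longleftrightarrow> (\<exists>b\<in>carrier B. a = adj B b \<otimes>\<^bsub>B\<^esub> b)"


section \<open>Hilbert modules\<close>

text \<open>Hilbert modules are right modules; the inner product is linear in the second argument.\<close>

record ('e, 'b) hmodule = "(complex, 'e) module" +
  ract :: "'e \<Rightarrow> 'b \<Rightarrow> 'e"
  ip :: "'e \<Rightarrow> 'e \<Rightarrow> 'b"

definition hnorm :: "'b cstar \<Rightarrow> ('e, 'b) hmodule \<Rightarrow> 'e \<Rightarrow> real"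
  where "hnorm B E x = sqrt (cnorm B (ip E x x))"

text \<open>By the Cauchy-Schwarz inequality every pre-Hilbert module is a normed space under
  \<open>hnorm\<close>, so of the parent locale \<open>complex_banach_space\<close> only completeness is an extra demand.\<close>

locale hilbert_module = B?: cstar_algebra B + E?: complex_banach_space E "hnorm B E"
  for B :: "'b cstar" and E :: "('e, 'b) hmodule" +
  assumes ract_closed: "\<lbrakk>x \<in> carrier E; b \<in> carrier B\<rbrakk> \<Longrightarrow> ract E x b \<in> carrier E"
    and ract_add_left: "\<lbrakk>x \<in> carrier E; y \<in> carrier E; b \<in> carrier B\<rbrakk>
      \<Longrightarrow> ract E (x \<oplus>\<^bsub>E\<^esub> y) b = ract E x b \<oplus>\<^bsub>E\<^esub> ract E y b"
    and ract_add_right: "\<lbrakk>x \<in> carrier E; a \<in> carrier B; b \<in> carrier B\<rbrakk>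
      \<Longrightarrow> ract E x (a \<oplus>\<^bsub>B\<^esub> b) = ract E x a \<oplus>\<^bsub>E\<^esub> ract E x b"
    and ract_mult: "\<lbrakk>x \<in> carrier E; a \<in> carrier B; b \<in> carrier B\<rbrakk>
      \<Longrightarrow> ract E x (a \<otimes>\<^bsub>B\<^esub> b) = ract E (ract E x a) b"
    and ract_smult_left: "\<lbrakk>x \<in> carrier E; b \<in> carrier B\<rbrakk>
      \<Longrightarrow> ract E (c \<odot>\<^bsub>E\<^esub> x) b = c \<odot>\<^bsub>E\<^esub> ract E x b"
    and ract_smult_right: "\<lbrakk>x \<in> carrier E; b \<in> carrier B\<rbrakk>
      \<Longrightarrow> ract E x (c \<odot>\<^bsub>B\<^esub> b) = c \<odot>\<^bsub>E\<^esub> ract E x b"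
    and ip_closed: "\<lbrakk>x \<in> carrier E; y \<in> carrier E\<rbrakk> \<Longrightarrow> ip E x y \<in> carrier B"
    and ip_add_right: "\<lbrakk>x \<in> carrier E; y \<in> carrier E; z \<in> carrier E\<rbrakk>
      \<Longrightarrow> ip E x (y \<oplus>\<^bsub>E\<^esub> z) = ip E x y \<oplus>\<^bsub>B\<^esub> ip E x z"
    and ip_smult_right: "\<lbrakk>x \<in> carrier E; y \<in> carrier E\<rbrakk>
      \<Longrightarrow> ip E x (c \<odot>\<^bsub>E\<^esub> y) = c \<odot>\<^bsub>B\<^esub> ip E x y"
    and ip_ract_right: "\<lbrakk>x \<in> carrier E; y \<in> carrier E; b \<in> carrier B\<rbrakk>
      \<Longrightarrow> ip E x (ract E y b) = ip E x y \<otimes>\<^bsub>B\<^esub> b"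
    and ip_adj: "\<lbrakk>x \<in> carrier E; y \<in> carrier E\<rbrakk> \<Longrightarrow> adj B (ip E x y) = ip E y x"
    and ip_positive: "x \<in> carrier E \<Longrightarrow> positive_in B (ip E x x)"
    and ip_definite: "\<lbrakk>x \<in> carrier E; ip E x x = \<zero>\<^bsub>B\<^esub>\<rbrakk> \<Longrightarrow> x = \<zero>\<^bsub>E\<^esub>"

definition htopology :: "'b cstar \<Rightarrow> ('e, 'b) hmodule \<Rightarrow> 'e topology"
  where "htopology B E = Metric_space.mtopology (carrier E) (norm_dist E (hnorm B E))"

definition closed_submodule :: "'b cstar \<Rightarrow> ('e, 'b) hmodule \<Rightarrow> 'e set \<Rightarrow> bool"
  where "closed_submodule B E F \<longleftrightarrow>
    subspace_of F E \<and> (\<forall>x\<in>F. \<forall>b\<in>carrier B. ract E x b \<in> F) \<and> closedin (htopology B E) F"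

definition perp :: "'b cstar \<Rightarrow> ('e, 'b) hmodule \<Rightarrow> 'e set \<Rightarrow> 'e set"
  where "perp B E F = {x \<in> carrier E. \<forall>y\<in>F. ip E y x = \<zero>\<^bsub>B\<^esub>}"


section \<open>Semigroups of isometries\<close>

text \<open>
  A semigroup is given by a total function \<open>s :: real \<Rightarrow> 'e \<Rightarrow> 'e\<close>, of which only the values at
  \<open>t \<ge> 0\<close> and on the carrier matter. None of the notions below uses that \<open>E\<close> is closed under the
  action of \<open>B\<close>, so they also apply to \<open>restr E W\<close> for a mere linear subspace \<open>W\<close> of \<open>E\<close>.
\<close>

definition restr :: "('e, 'b) hmodule \<Rightarrow> 'e set \<Rightarrow> ('e, 'b) hmodule"
  where "restr E W = E\<lparr>carrier := W\<rparr>"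

definition linear_map :: "('e, 'b) hmodule \<Rightarrow> ('e \<Rightarrow> 'e) \<Rightarrow> bool"
  where "linear_map E f \<longleftrightarrow>
    f \<in> carrier E \<rightarrow> carrier E \<and>
    (\<forall>x\<in>carrier E. \<forall>y\<in>carrier E. f (x \<oplus>\<^bsub>E\<^esub> y) = f x \<oplus>\<^bsub>E\<^esub> f y) \<and>
    (\<forall>c. \<forall>x\<in>carrier E. f (c \<odot>\<^bsub>E\<^esub> x) = c \<odot>\<^bsub>E\<^esub> f x)"

definition isometry :: "('e, 'b) hmodule \<Rightarrow> ('e \<Rightarrow> 'e) \<Rightarrow> bool"
  where "isometry E f \<longleftrightarrow>
    linear_map E f \<and> (\<forall>x\<in>carrier E. \<forall>y\<in>carrier E. ip E (f x) (f y) = ip E x y)"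

definition unitary :: "('e, 'b) hmodule \<Rightarrow> ('e \<Rightarrow> 'e) \<Rightarrow> bool"
  where "unitary E f \<longleftrightarrow> isometry E f \<and> f ` carrier E = carrier E"

definition linear_semigroup :: "('e, 'b) hmodule \<Rightarrow> (real \<Rightarrow> 'e \<Rightarrow> 'e) \<Rightarrow> bool"
  where "linear_semigroup E s \<longleftrightarrow>
    (\<forall>t\<ge>0. linear_map E (s t)) \<and>
    (\<forall>r\<ge>0. \<forall>t\<ge>0. \<forall>x\<in>carrier E. s r (s t x) = s (r + t) x) \<and>
    (\<forall>x\<in>carrier E. s 0 x = x)"

definition isometry_semigroup :: "('e, 'b) hmodule \<Rightarrow> (real \<Rightarrow> 'e \<Rightarrow> 'e) \<Rightarrow> bool"
  where "isometry_semigroup E s \<longleftrightarrow> linear_semigroup E s \<and> (\<forall>t\<ge>0. isometry E (s t))"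

definition unitary_semigroup :: "('e, 'b) hmodule \<Rightarrow> (real \<Rightarrow> 'e \<Rightarrow> 'e) \<Rightarrow> bool"
  where "unitary_semigroup E s \<longleftrightarrow> linear_semigroup E s \<and> (\<forall>t\<ge>0. unitary E (s t))"

definition completely_nonunitary :: "('e, 'b) hmodule \<Rightarrow> (real \<Rightarrow> 'e \<Rightarrow> 'e) \<Rightarrow> bool"
  where "completely_nonunitary E s \<longleftrightarrow>
    isometry_semigroup E s \<and>
    (\<forall>W. subspace_of W E \<and> (\<forall>t\<ge>0. s t ` W = W) \<longrightarrow> W = {\<zero>\<^bsub>E\<^esub>})"

definition reduces :: "('e, 'b) hmodule \<Rightarrow> 'e set \<Rightarrow> (real \<Rightarrow> 'e \<Rightarrow> 'e) \<Rightarrow> bool"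
  where "reduces E W s \<longleftrightarrow> subspace_of W E \<and> (\<forall>t\<ge>0. s t ` W \<subseteq> W)"

definition reduces_to_unitaries ::
    "('e, 'b) hmodule \<Rightarrow> 'e set \<Rightarrow> (real \<Rightarrow> 'e \<Rightarrow> 'e) \<Rightarrow> bool"
  where "reduces_to_unitaries E W s \<longleftrightarrow> reduces E W s \<and> unitary_semigroup (restr E W) s"

definition reduces_to_completely_nonunitary ::
    "('e, 'b) hmodule \<Rightarrow> 'e set \<Rightarrow> (real \<Rightarrow> 'e \<Rightarrow> 'e) \<Rightarrow> bool"
  where "reduces_to_completely_nonunitary E W s \<longleftrightarrow>
    reduces E W s \<and> completely_nonunitary (restr E W) s"

definition completely_reducing ::
    "'b cstar \<Rightarrow> ('e, 'b) hmodule \<Rightarrow> 'e set \<Rightarrow> (real \<Rightarrow> 'e \<Rightarrow> 'e) \<Rightarrow> bool"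
  where "completely_reducing B E F s \<longleftrightarrow>
    closed_submodule B E F \<and> reduces E F s \<and> reduces E (perp B E F) s"

definition unitary_part :: "('e, 'b) hmodule \<Rightarrow> (real \<Rightarrow> 'e \<Rightarrow> 'e) \<Rightarrow> 'e set"
  where "unitary_part E s = (\<Inter>t\<in>{0..}. s t ` carrier E)"

end

theory Submission
  imports Defs
begin

text \<open>
  Since \<open>s\<^sub>t\<close> is an isometry, its range is complete and it commutes with the module action, so
  \<open>E\<^sub>u\<close> is an intersection of closed submodules. It satisfies \<open>s\<^sub>t E\<^sub>u = E\<^sub>u\<close>, so every
  \<open>y \<in> E\<^sub>u\<close> is \<open>s\<^sub>t z\<close> with \<open>z \<in> E\<^sub>u\<close>, and \<open>\<langle>y, s\<^sub>t x\<rangle> = \<langle>z, x\<rangle>\<close> shows that \<open>s\<^sub>t\<close> preserves the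
  orthogonal complement. A subspace \<open>W\<close> with \<open>s\<^sub>t W = W\<close> for all \<open>t\<close> lies in \<open>E\<^sub>u\<close>.

  For the counterexample, let \<open>E\<close> be the continuous sections over the one-point compactification of
  the naturals with fibre \<open>\<ell>\<^sup>2\<close> over the discrete real line. A sequence of unitary translation groups
  can converge strongly to the shift of the half line. With these groups over the finite points and the
  shift over infinity, the section \<open>\<delta>\<^sub>0\<close> supported at one finite point lies in \<open>E\<^sub>u\<close>. Hence an
  element of \<open>E\<^sub>u\<^sup>\<bottom>\<close> has coordinate 0 equal to zero over the finite points, and by continuity over
  infinity. An element of \<open>E\<^sub>u\<close> has coordinate 0 equal to zero over infinity, because 0 is off the
  range of the shift. So the constant section \<open>\<delta>\<^sub>0\<close> is not in the sum.
\<close>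

section \<open>The complex numbers as a ring of scalars\<close>

lemma complex_ring_simps [simp]:
  "carrier complex_ring = UNIV" "\<zero>\<^bsub>complex_ring\<^esub> = 0" "\<one>\<^bsub>complex_ring\<^esub> = 1"
  "a \<oplus>\<^bsub>complex_ring\<^esub> b = a + b" "a \<otimes>\<^bsub>complex_ring\<^esub> b = a * b"
  by (simp_all add: ring_of_type_algebra_def)

lemma a_inv_complex_ring [simp]: "\<ominus>\<^bsub>complex_ring\<^esub> a = - a"
proof -
  interpret cring complex_ring ..
  show ?thesis by (rule minus_equality) auto
qed

section \<open>The metric of a normed space\<close>

text \<open>The axioms of \<open>complex_banach_space\<close> without completeness, so that the
  metric is available in a concrete space while its completeness is still to be proved.\<close>

locale complex_normed_space = Module.module complex_ring M
  for M :: "(complex, 'a, 'm) module_scheme" (structure) and N :: "'a \<Rightarrow> real" +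
  assumes norm_nonneg: "x \<in> carrier M \<Longrightarrow> 0 \<le> N x"
    and norm_eq_zero_iff: "x \<in> carrier M \<Longrightarrow> N x = 0 \<longleftrightarrow> x = \<zero>\<^bsub>M\<^esub>"
    and norm_smult: "x \<in> carrier M \<Longrightarrow> N (c \<odot>\<^bsub>M\<^esub> x) = cmod c * N x"
    and norm_triangle: "x \<in> carrier M \<Longrightarrow> y \<in> carrier M \<Longrightarrow> N (x \<oplus>\<^bsub>M\<^esub> y) \<le> N x + N y"
begin

lemma uminus_eq_smult: "x \<in> carrier M \<Longrightarrow> \<ominus>\<^bsub>M\<^esub> x = (-1) \<odot>\<^bsub>M\<^esub> x"
  using smult_l_minus[of 1 x] smult_one[of x] by simp

lemma minus_eq_smult:
  "\<lbrakk>x \<in> carrier M; y \<in> carrier M\<rbrakk> \<Longrightarrow> x \<ominus>\<^bsub>M\<^esub> y = x \<oplus>\<^bsub>M\<^esub> (-1) \<odot>\<^bsub>M\<^esub> y"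
  by (simp add: a_minus_def uminus_eq_smult)

lemma minus_eq_zero_iff:
  assumes "x \<in> carrier M" "y \<in> carrier M"
  shows "x \<ominus>\<^bsub>M\<^esub> y = \<zero>\<^bsub>M\<^esub> \<longleftrightarrow> x = y"
proof
  assume "x \<ominus>\<^bsub>M\<^esub> y = \<zero>\<^bsub>M\<^esub>"
  then show "x = y"
    using M.minus_equality[of x "\<ominus>\<^bsub>M\<^esub> y"] assms by (simp add: a_minus_def)
qed (use assms in \<open>simp add: a_minus_def M.r_neg\<close>)

lemma zero_smult: "x \<in> carrier M \<Longrightarrow> 0 \<odot>\<^bsub>M\<^esub> x = \<zero>\<^bsub>M\<^esub>"
  using smult_l_null[of x] by simp

lemma smult_closed': "x \<in> carrier M \<Longrightarrow> c \<odot>\<^bsub>M\<^esub> x \<in> carrier M"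
  by simp

sublocale metric: Metric_space "carrier M" "norm_dist M N"
proof
  fix x y
  show "0 \<le> norm_dist M N x y"
    by (auto simp: norm_dist_def intro: norm_nonneg)
  show "norm_dist M N x y = norm_dist M N y x"
  proof (cases "x \<in> carrier M \<and> y \<in> carrier M")
    case True
    then have "y \<ominus>\<^bsub>M\<^esub> x = (-1) \<odot>\<^bsub>M\<^esub> (x \<ominus>\<^bsub>M\<^esub> y)"
      by (simp add: uminus_eq_smult[symmetric] a_minus_def M.minus_add M.minus_minus M.a_comm)
    then show ?thesis
      using True norm_smult[of "x \<ominus>\<^bsub>M\<^esub> y" "-1"] by (simp add: norm_dist_def)
  qed (auto simp: norm_dist_def)
next
  fix x y
  assume "x \<in> carrier M" "y \<in> carrier M"
  then show "norm_dist M N x y = 0 \<longleftrightarrow> x = y"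
    by (simp add: norm_dist_def norm_eq_zero_iff minus_eq_zero_iff)
next
  fix x y z
  assume xyz: "x \<in> carrier M" "y \<in> carrier M" "z \<in> carrier M"
  then have "x \<ominus>\<^bsub>M\<^esub> z = (x \<ominus>\<^bsub>M\<^esub> y) \<oplus>\<^bsub>M\<^esub> (y \<ominus>\<^bsub>M\<^esub> z)"
    by (simp add: a_minus_def M.a_assoc M.r_neg1)
  then show "norm_dist M N x z \<le> norm_dist M N x y + norm_dist M N y z"
    using xyz norm_triangle[of "x \<ominus>\<^bsub>M\<^esub> y" "y \<ominus>\<^bsub>M\<^esub> z"] by (simp add: norm_dist_def)
qed

end

sublocale complex_banach_space \<subseteq> normed: complex_normed_space
  by unfold_locales (auto intro: norm_nonneg norm_smult norm_triangle simp: norm_eq_zero_iff)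

section \<open>Isometries of Hilbert modules\<close>

context hilbert_module
begin

lemma ip_zero_right: "x \<in> carrier E \<Longrightarrow> ip E x \<zero>\<^bsub>E\<^esub> = \<zero>\<^bsub>B\<^esub>"
  using ip_smult_right[of x "\<zero>\<^bsub>E\<^esub>" 0] ip_closed[of x "\<zero>\<^bsub>E\<^esub>"]
    by (simp add: E.normed.zero_smult B.normed.zero_smult)

lemma ip_eq_zero_sym:
  assumes "x \<in> carrier E" "y \<in> carrier E" "ip E x y = \<zero>\<^bsub>B\<^esub>"
  shows "ip E y x = \<zero>\<^bsub>B\<^esub>"
proof -
  have "adj B \<zero>\<^bsub>B\<^esub> = \<zero>\<^bsub>B\<^esub>"
    using adj_smult[of "\<zero>\<^bsub>B\<^esub>" 0] adj_closed[of "\<zero>\<^bsub>B\<^esub>"]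
    by (simp add: B.normed.zero_smult)
  then show ?thesis
    using assms ip_adj[of x y] by simp
qed

lemma ip_minus_right:
  assumes "x \<in> carrier E" "y \<in> carrier E" "z \<in> carrier E"
  shows "ip E x (y \<ominus>\<^bsub>E\<^esub> z) = ip E x y \<ominus>\<^bsub>B\<^esub> ip E x z"
  using assms
  by (simp add: E.normed.minus_eq_smult B.normed.minus_eq_smult ip_add_right ip_smult_right ip_closed)

text \<open>The difference of \<open>x\<close> and \<open>y\<close> is orthogonal to both, hence to
  itself, and definiteness applies. Vectors can thus be identified through inner products where no
  adjoint of a map exists.\<close>

lemma eqI_ip:
  assumes "x \<in> carrier E" "y \<in> carrier E"
    and "ip E x x = ip E x y" "ip E y x = ip E y y"
  shows "x = y"
proof -
  let ?d = "x \<ominus>\<^bsub>E\<^esub> y"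
  have d: "?d \<in> carrier E"
    using assms by simp
  have "ip E x ?d = \<zero>\<^bsub>B\<^esub>" "ip E y ?d = \<zero>\<^bsub>B\<^esub>"
    using assms by (auto simp: ip_minus_right ip_closed B.normed.minus_eq_zero_iff)
  then have "ip E ?d x = \<zero>\<^bsub>B\<^esub>" "ip E ?d y = \<zero>\<^bsub>B\<^esub>"
    using assms(1,2) d by (blast intro: ip_eq_zero_sym)+
  then have "ip E ?d ?d = \<zero>\<^bsub>B\<^esub>"
    using assms d by (simp add: ip_minus_right B.normed.minus_eq_zero_iff)
  then have "?d = \<zero>\<^bsub>E\<^esub>"
    using d ip_definite by blast
  then show ?thesis
    using assms by (simp add: E.normed.minus_eq_zero_iff)
qed

lemma isometry_closed: "\<lbrakk>isometry E f; x \<in> carrier E\<rbrakk> \<Longrightarrow> f x \<in> carrier E"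
  by (auto simp: isometry_def linear_map_def)

lemma isometry_ip:
  "\<lbrakk>isometry E f; x \<in> carrier E; y \<in> carrier E\<rbrakk> \<Longrightarrow> ip E (f x) (f y) = ip E x y"
  by (auto simp: isometry_def)

lemma isometry_add:
  "\<lbrakk>isometry E f; x \<in> carrier E; y \<in> carrier E\<rbrakk> \<Longrightarrow> f (x \<oplus>\<^bsub>E\<^esub> y) = f x \<oplus>\<^bsub>E\<^esub> f y"
  by (auto simp: isometry_def linear_map_def)

lemma isometry_smult:
  "\<lbrakk>isometry E f; x \<in> carrier E\<rbrakk> \<Longrightarrow> f (c \<odot>\<^bsub>E\<^esub> x) = c \<odot>\<^bsub>E\<^esub> f x"
  by (auto simp: isometry_def linear_map_def)

lemma isometry_minus:
  "\<lbrakk>isometry E f; x \<in> carrier E; y \<in> carrier E\<rbrakk> \<Longrightarrow> f (x \<ominus>\<^bsub>E\<^esub> y) = f x \<ominus>\<^bsub>E\<^esub> f y"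
  by (simp add: E.normed.minus_eq_smult isometry_closed isometry_add isometry_smult)

text \<open>An isometry is only assumed complex linear. All four inner products between
  \<open>f (ract E x b)\<close> and \<open>ract E (f x) b\<close> equal that of
  \<open>ract E x b\<close> with itself, so \<open>eqI_ip\<close> identifies the two
  vectors.\<close>

lemma isometry_ract:
  assumes f: "isometry E f" and x: "x \<in> carrier E" and b: "b \<in> carrier B"
  shows "f (ract E x b) = ract E (f x) b"
proof (rule eqI_ip)
  note [simp] = isometry_closed[OF f] isometry_ip[OF f] x b ract_closed ip_ract_right
  let ?y = "f (ract E x b)" and ?z = "ract E (f x) b" and ?w = "ract E x b"
  show "?y \<in> carrier E" "?z \<in> carrier E"
    by auto
  have yz: "ip E ?y ?z = ip E ?w ?w"
    by (simp del: ip_ract_right add: ip_ract_right[of _ "f x"] ip_ract_right[of _ x])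
  then show "ip E ?y ?y = ip E ?y ?z"
    by (simp del: ip_ract_right)
  \<comment> \<open>The action can be pulled out of the second argument only, so the first argument
    is treated by passing to adjoints.\<close>
  have "ip E ?z (f x) = adj B (ip E (f x) ?z)"
    by (simp add: ip_adj del: ip_ract_right)
  also have "\<dots> = adj B (ip E x ?w)"
    by simp
  finally have zx: "ip E ?z (f x) = ip E ?w x"
    by (simp add: ip_adj del: ip_ract_right)
  have "ip E ?z ?z = ip E ?w ?w"
    using zx by (simp del: ip_ract_right add: ip_ract_right[of _ "f x"] ip_ract_right[of _ x])
  moreover have "ip E ?z ?y = ip E ?w ?w"
    using yz ip_adj[of ?y ?z] ip_adj[of ?w ?w] by (simp del: ip_ract_right)
  ultimately show "ip E ?z ?y = ip E ?z ?z"
    by simp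
qed

lemma isometry_inj: "isometry E f \<Longrightarrow> inj_on f (carrier E)"
  by (rule inj_onI, rule eqI_ip) (simp_all flip: isometry_ip[of f])

lemma isometry_dist:
  "\<lbrakk>isometry E f; x \<in> carrier E; y \<in> carrier E\<rbrakk>
    \<Longrightarrow> norm_dist E (hnorm B E) (f x) (f y) = norm_dist E (hnorm B E) x y"
  by (simp add: norm_dist_def isometry_closed isometry_minus[symmetric] hnorm_def isometry_ip)

text \<open>Closedness rests on completeness of \<open>E\<close>: distances are preserved, so the
  preimages of a convergent sequence are Cauchy, and \<open>f\<close> maps their limit to the given
  one.\<close>

lemma closed_submodule_isometry_image:
  assumes f: "isometry E f"
  shows "closed_submodule B E (f ` carrier E)"
proof -
  have "submodule (f ` carrier E) complex_ring E"
  proof (rule E.submoduleI)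
    show "f ` carrier E \<subseteq> carrier E"
      using isometry_closed[OF f] by blast
    have "f \<zero>\<^bsub>E\<^esub> = \<zero>\<^bsub>E\<^esub>"
      using isometry_smult[OF f, of "\<zero>\<^bsub>E\<^esub>" 0] isometry_closed[OF f, of "\<zero>\<^bsub>E\<^esub>"]
        by (simp add: E.normed.zero_smult)
    then show "\<zero>\<^bsub>E\<^esub> \<in> f ` carrier E"
      using imageI[of "\<zero>\<^bsub>E\<^esub>" "carrier E" f] by simp
    show sm: "c \<odot>\<^bsub>E\<^esub> x \<in> f ` carrier E" if "x \<in> f ` carrier E" for c x
      using that by (auto simp: isometry_smult[OF f, symmetric] E.normed.smult_closed')
    show "\<ominus>\<^bsub>E\<^esub> x \<in> f ` carrier E" if "x \<in> f ` carrier E" for x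
      using sm[OF that, of "-1"] that isometry_closed[OF f] by (auto simp: E.normed.uminus_eq_smult)
    show "x \<oplus>\<^bsub>E\<^esub> y \<in> f ` carrier E" if "x \<in> f ` carrier E" "y \<in> f ` carrier E" for x y
      using that by (auto simp: isometry_add[OF f, symmetric])
  qed
  moreover have "ract E x b \<in> f ` carrier E" if "x \<in> f ` carrier E" "b \<in> carrier B" for x b
    using that by (auto simp: isometry_ract[OF f, symmetric] ract_closed)
  moreover have "closedin (htopology B E) (f ` carrier E)"
    unfolding htopology_def E.normed.metric.metric_closedin_iff_sequentially_closed
  proof (intro conjI allI impI)
    show "f ` carrier E \<subseteq> carrier E"
      using isometry_closed[OF f] by blast
    fix \<sigma> l
    assume "range \<sigma> \<subseteq> f ` carrier E \<and> limitin E.normed.metric.mtopology \<sigma> l sequentially"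
    then have ran: "range \<sigma> \<subseteq> f ` carrier E"
      and lim: "limitin E.normed.metric.mtopology \<sigma> l sequentially" by auto
    have "\<exists>y. y \<in> carrier E \<and> \<sigma> n = f y" for n
      using subsetD[OF ran, of "\<sigma> n"] by (auto simp: image_iff)
    then obtain \<tau> where \<tau>: "\<And>n. \<tau> n \<in> carrier E" "\<And>n. \<sigma> n = f (\<tau> n)"
      by metis
    have "range \<sigma> \<subseteq> carrier E"
      using \<tau> isometry_closed[OF f] by (simp add: image_subset_iff)
    then have "E.normed.metric.MCauchy \<sigma>"
      using lim by (rule E.normed.metric.convergent_imp_MCauchy)
    then have "E.normed.metric.MCauchy \<tau>"
      using \<tau> by (auto simp: E.normed.metric.MCauchy_def isometry_dist[OF f])
    then obtain y where y: "limitin E.normed.metric.mtopology \<tau> y sequentially"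
      using E.complete by (auto simp: E.normed.metric.mcomplete_def)
    then have "y \<in> carrier E"
      by (rule E.normed.metric.limitin_mspace)
    then have "limitin E.normed.metric.mtopology \<sigma> (f y) sequentially"
      using y \<tau> by (simp add: E.normed.metric.limitin_metric isometry_dist[OF f] isometry_closed[OF f])
    then show "l \<in> f ` carrier E"
      using E.normed.metric.limitin_metric_unique[OF lim] \<open>y \<in> carrier E\<close> by auto
  qed
  ultimately show ?thesis
    by (auto simp: closed_submodule_def)
qed

lemma closed_submodule_INT:
  assumes "I \<noteq> {}" and F: "\<And>i. i \<in> I \<Longrightarrow> closed_submodule B E (F i)"
  shows "closed_submodule B E (\<Inter>i\<in>I. F i)"
proof -
  have sub: "subspace_of (F i) E" if "i \<in> I" for i
    using F[OF that] by (simp add: closed_submodule_def)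
  note subE = E.submoduleE[OF sub]
  have "submodule (\<Inter>i\<in>I. F i) complex_ring E"
  proof (rule E.submoduleI)
    show "(\<Inter>i\<in>I. F i) \<subseteq> carrier E"
      using assms(1) subE(1) by fast
    show "\<zero>\<^bsub>E\<^esub> \<in> (\<Inter>i\<in>I. F i)"
      using subgroup.one_closed[OF submodule.axioms(1)[OF sub]] by simp
  qed (simp_all add: subE)
  moreover have "closedin (htopology B E) (\<Inter>i\<in>I. F i)"
    using assms by (auto simp: closed_submodule_def)
  moreover have "ract E x b \<in> F i" if "x \<in> F i" "i \<in> I" "b \<in> carrier B" for x b i
    using F[OF that(2)] that by (simp add: closed_submodule_def)
  ultimately show ?thesis
    by (simp add: closed_submodule_def)
qed

lemma subspace_perp:
  assumes "F \<subseteq> carrier E"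
  shows "subspace_of (perp B E F) E"
proof (rule E.submoduleI)
  show sm: "c \<odot>\<^bsub>E\<^esub> x \<in> perp B E F" if "x \<in> perp B E F" for c x
    using that assms by (auto simp: perp_def ip_smult_right subset_iff)
  then show "\<ominus>\<^bsub>E\<^esub> x \<in> perp B E F" if "x \<in> perp B E F" for x
    using that sm[of x "-1"] by (auto simp: E.normed.uminus_eq_smult perp_def)
  show "x \<oplus>\<^bsub>E\<^esub> y \<in> perp B E F" if "x \<in> perp B E F" "y \<in> perp B E F" for x y
    using that assms by (simp add: perp_def ip_add_right subset_iff)
qed (use assms in \<open>simp_all add: perp_def ip_zero_right subset_iff\<close>)

lemma inter_perp_subset: "F \<inter> perp B E F \<subseteq> {\<zero>\<^bsub>E\<^esub>}"
proof
  fix x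
  assume "x \<in> F \<inter> perp B E F"
  then have "x \<in> carrier E" "ip E x x = \<zero>\<^bsub>B\<^esub>"
    by (simp_all add: perp_def)
  then show "x \<in> {\<zero>\<^bsub>E\<^esub>}"
    using ip_definite by simp
qed

end

section \<open>The unitary part\<close>

locale isometry_semigroup_on = hilbert_module B E
  for B :: "'b cstar" and E :: "('e, 'b) hmodule" and s :: "real \<Rightarrow> 'e \<Rightarrow> 'e" +
  assumes isometry_semigroup: "isometry_semigroup E s"
begin

lemma isometry_s: "0 \<le> t \<Longrightarrow> isometry E (s t)"
  using isometry_semigroup by (auto simp: isometry_semigroup_def)

lemma s_s: "\<lbrakk>0 \<le> r; 0 \<le> t; x \<in> carrier E\<rbrakk> \<Longrightarrow> s r (s t x) = s (r + t) x"
  using isometry_semigroup by (auto simp: isometry_semigroup_def linear_semigroup_def)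

lemma s_zero: "x \<in> carrier E \<Longrightarrow> s 0 x = x"
  using isometry_semigroup by (auto simp: isometry_semigroup_def linear_semigroup_def)

lemma s_closed: "\<lbrakk>0 \<le> t; x \<in> carrier E\<rbrakk> \<Longrightarrow> s t x \<in> carrier E"
  using isometry_closed isometry_s by blast

lemma closed_submodule_unitary_part: "closed_submodule B E (unitary_part E s)"
  unfolding unitary_part_def
  by (rule closed_submodule_INT) (simp_all add: closed_submodule_isometry_image isometry_s)

lemma unitary_part_subset: "unitary_part E s \<subseteq> carrier E"
proof
  fix x
  assume "x \<in> unitary_part E s"
  then have "x \<in> s 0 ` carrier E"
    by (simp add: unitary_part_def)
  then show "x \<in> carrier E"
    by (auto simp: s_zero)
qed

text \<open>The maps commute, so \<open>s t\<close> carries the range of each \<open>s r\<close>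
  into itself. Conversely, a preimage under \<open>s t\<close> is unique and therefore lies in every
  range.\<close>

lemma image_unitary_part:
  assumes t: "0 \<le> t"
  shows "s t ` unitary_part E s = unitary_part E s"
proof
  show "s t ` unitary_part E s \<subseteq> unitary_part E s"
  proof
    fix y
    assume "y \<in> s t ` unitary_part E s"
    then obtain x where x: "x \<in> unitary_part E s" "y = s t x"
      by blast
    have "y \<in> s r ` carrier E" if r: "0 \<le> r" for r
    proof -
      obtain z where z: "z \<in> carrier E" "x = s r z"
        using x r by (auto simp: unitary_part_def)
      then have "y = s r (s t z)"
        using r t x(2) by (simp add: s_s add.commute)
      then show ?thesis
        using s_closed[OF t z(1)] by simp
    qed
    then show "y \<in> unitary_part E s"
      by (auto simp: unitary_part_def)
  qed
  show "unitary_part E s \<subseteq> s t ` unitary_part E s"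
  proof
    fix x
    assume x: "x \<in> unitary_part E s"
    then obtain y where y: "y \<in> carrier E" "x = s t y"
      using t by (auto simp: unitary_part_def)
    have "y \<in> s r ` carrier E" if r: "0 \<le> r" for r
    proof -
      \<comment> \<open>Going back from \<open>x\<close> by \<open>t + r\<close> and cancelling the
        injective \<open>s t\<close> takes \<open>y\<close> back by \<open>r\<close>.\<close>
      obtain z where z: "z \<in> carrier E" "x = s (t + r) z"
        using x t r
        by (auto simp: unitary_part_def dest!: bspec[of _ _ "t + r"])
      then have "s t y = s t (s r z)"
        using y t r by (simp add: s_s)
      then have "y = s r z"
        using inj_onD[OF isometry_inj[OF isometry_s[OF t]]] y z s_closed[OF r] by simp
      then show ?thesis
        using z by simp
    qed
    then show "x \<in> s t ` unitary_part E s"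
      using y by (auto simp: unitary_part_def)
  qed
qed

text \<open>Such a \<open>W\<close> lies in the range of every \<open>s t\<close>. This serves both
  the maximality of the unitary part and the complete nonunitarity on its complement.\<close>

lemma subset_unitary_part:
  assumes "W \<subseteq> carrier E" "\<And>t. 0 \<le> t \<Longrightarrow> s t ` W = W"
  shows "W \<subseteq> unitary_part E s"
proof
  fix x
  assume "x \<in> W"
  then have "x \<in> s t ` carrier E" if "0 \<le> t" for t
    using assms(1) assms(2)[OF that] by blast
  then show "x \<in> unitary_part E s"
    by (simp add: unitary_part_def)
qed

lemma carrier_restr: "carrier (restr E W) = W"
  by (simp add: restr_def)

lemma isometry_semigroup_restr:
  assumes "W \<subseteq> carrier E" "\<And>t. 0 \<le> t \<Longrightarrow> s t ` W \<subseteq> W"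
  shows "isometry_semigroup (restr E W) s"
proof -
  have "isometry (restr E W) (s t)" if "0 \<le> t" for t
    using assms(1) assms(2)[OF that] isometry_s[OF that]
    by (simp add: isometry_def linear_map_def restr_def subset_iff Pi_iff image_subset_iff)
  then show ?thesis
    using assms(1)
    by (simp add: isometry_semigroup_def linear_semigroup_def isometry_def restr_def subset_iff s_s s_zero)
qed

text \<open>Linearity, the semigroup law and inner products are inherited by an invariant subspace,
  so unitarity of the restriction comes down to surjectivity.\<close>

lemma reduces_to_unitaries_iff:
  assumes "subspace_of W E"
  shows "reduces_to_unitaries E W s \<longleftrightarrow> (\<forall>t\<ge>0. s t ` W = W)"
proof -
  have "W \<subseteq> carrier E"
    using assms E.submoduleE(1) by blast
  then show ?thesis
    using assms isometry_semigroup_restr[of W]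
    by (simp add: reduces_to_unitaries_def reduces_def unitary_semigroup_def unitary_def
        isometry_semigroup_def carrier_restr) (metis order_refl)
qed

lemma reduces_perp_unitary_part: "reduces E (perp B E (unitary_part E s)) s"
  unfolding reduces_def
proof (intro conjI allI impI)
  show "subspace_of (perp B E (unitary_part E s)) E"
    by (rule subspace_perp[OF unitary_part_subset])
  fix t :: real
  assume t: "0 \<le> t"
  show "s t ` perp B E (unitary_part E s) \<subseteq> perp B E (unitary_part E s)"
  proof (clarsimp simp: perp_def s_closed[OF t])
    fix x y
    assume x: "x \<in> carrier E" "\<forall>y\<in>unitary_part E s. ip E y x = \<zero>\<^bsub>B\<^esub>"
      and "y \<in> unitary_part E s"
    \<comment> \<open>Pulling \<open>y\<close> back within the unitary part replaces the missing
      adjoint: its inner product with \<open>s t x\<close> is that of \<open>z\<close> with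
      \<open>x\<close>.\<close>
    then obtain z where "z \<in> unitary_part E s" "y = s t z"
      using image_unitary_part[OF t] by blast
    then show "ip E y (s t x) = \<zero>\<^bsub>B\<^esub>"
      using x(1) bspec[OF x(2)] subsetD[OF unitary_part_subset]
      by (simp add: isometry_ip[OF isometry_s[OF t]])
  qed
qed

text \<open>A subspace of the complement that every \<open>s t\<close> maps onto itself also lies in
  the unitary part, which meets its complement only in zero.\<close>

lemma reduces_to_completely_nonunitary_perp:
  "reduces_to_completely_nonunitary E (perp B E (unitary_part E s)) s"
proof -
  let ?P = "perp B E (unitary_part E s)"
  have P: "?P \<subseteq> carrier E"
    by (auto simp: perp_def)
  have "isometry_semigroup (restr E ?P) s"
    using P reduces_perp_unitary_part by (intro isometry_semigroup_restr) (auto simp: reduces_def)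
  moreover have "W = {\<zero>\<^bsub>restr E ?P\<^esub>}"
    if W: "subspace_of W (restr E ?P)" "\<forall>t\<ge>0. s t ` W = W" for W
  proof -
    have "subgroup W (add_monoid (restr E ?P))"
      using W(1) submodule.axioms(1) by blast
    then have WP: "W \<subseteq> ?P" and z: "\<zero>\<^bsub>E\<^esub> \<in> W"
      using subgroup.subset subgroup.one_closed by (fastforce simp: restr_def)+
    then have "W \<subseteq> unitary_part E s"
      using W(2) P by (intro subset_unitary_part) auto
    then show ?thesis
      using WP z inter_perp_subset by (auto simp: restr_def)
  qed
  ultimately show ?thesis
    using reduces_perp_unitary_part
    by (auto simp: reduces_to_completely_nonunitary_def completely_nonunitary_def)
qed

lemma unitary_part_decomposition:
  shows "completely_reducing B E (unitary_part E s) s"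
    and "reduces_to_unitaries E (unitary_part E s) s"
    and "\<lbrakk>closed_submodule B E F; reduces_to_unitaries E F s\<rbrakk> \<Longrightarrow> F \<subseteq> unitary_part E s"
proof -
  have sub: "subspace_of (unitary_part E s) E"
    using closed_submodule_unitary_part by (simp add: closed_submodule_def)
  then show "reduces_to_unitaries E (unitary_part E s) s"
    using reduces_to_unitaries_iff image_unitary_part by blast
  show "completely_reducing B E (unitary_part E s) s"
    using sub closed_submodule_unitary_part reduces_perp_unitary_part image_unitary_part
    by (auto simp: completely_reducing_def reduces_def)
  show "F \<subseteq> unitary_part E s" if "closed_submodule B E F" "reduces_to_unitaries E F s"
    using that reduces_to_unitaries_iff[of F] E.submoduleE(1)[of F]
    by (intro subset_unitary_part) (auto simp: closed_submodule_def)
qed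

end

section \<open>Square summable families\<close>

definition l2 :: "('i \<Rightarrow> complex) set"
  where "l2 = {f. (\<lambda>i. (cmod (f i))\<^sup>2) summable_on UNIV}"

text \<open>\<open>infsum\<close> is 0 on families that are not summable, so nonnegativity and
  homogeneity hold for all functions.\<close>

definition l2norm :: "('i \<Rightarrow> complex) \<Rightarrow> real"
  where "l2norm f = sqrt (\<Sum>\<^sub>\<infinity>i. (cmod (f i))\<^sup>2)"

definition l2ip :: "('i \<Rightarrow> complex) \<Rightarrow> ('i \<Rightarrow> complex) \<Rightarrow> complex"
  where "l2ip f g = (\<Sum>\<^sub>\<infinity>i. cnj (f i) * g i)"

lemma l2norm_nonneg [simp]: "0 \<le> l2norm f"
  by (simp add: l2norm_def infsum_nonneg)

text \<open>A bound uniform in the finite sets gives summability and the norm bound at once.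
  Minkowski's inequality and the passage to limits are reduced to finite sums through it.\<close>

lemma l2_bounded:
  assumes "\<And>F. finite F \<Longrightarrow> L2_set (\<lambda>i. cmod (f i)) F \<le> c"
  shows "f \<in> l2" "l2norm f \<le> c"
proof -
  have c: "0 \<le> c"
    using assms[of "{}"] by simp
  have le: "(\<Sum>i\<in>F. (cmod (f i))\<^sup>2) \<le> c\<^sup>2" if "finite F" for F
    using assms[OF that] c by (simp add: L2_set_def sqrt_le_D)
  then have sm: "(\<lambda>i. (cmod (f i))\<^sup>2) summable_on UNIV"
    by (intro nonneg_bdd_above_summable_on) (auto intro!: bdd_aboveI[of _ "c\<^sup>2"])
  then show "f \<in> l2"
    by (simp add: l2_def)
  have "(\<Sum>\<^sub>\<infinity>i. (cmod (f i))\<^sup>2) \<le> c\<^sup>2"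
    using sm le by (intro infsum_le_finite_sums) auto
  then show "l2norm f \<le> c"
    using c by (simp add: l2norm_def real_le_lsqrt infsum_nonneg)
qed

lemma L2_set_le_l2norm:
  assumes "f \<in> l2" "finite F"
  shows "L2_set (\<lambda>i. cmod (f i)) F \<le> l2norm f"
  using assms unfolding l2_def l2norm_def L2_set_def
  by (auto intro!: real_sqrt_le_mono finite_sum_le_infsum)

lemma norm_le_l2norm: "f \<in> l2 \<Longrightarrow> cmod (f i) \<le> l2norm f"
  using L2_set_le_l2norm[of f "{i}"] by simp

lemma zero_l2: "(\<lambda>i. 0) \<in> l2" "l2norm (\<lambda>i. 0) = 0"
  by (simp_all add: l2_def l2norm_def)

lemma add_l2:
  assumes "f \<in> l2" "g \<in> l2"
  shows "(\<lambda>i. f i + g i) \<in> l2" "l2norm (\<lambda>i. f i + g i) \<le> l2norm f + l2norm g"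
proof -
  have "L2_set (\<lambda>i. cmod (f i + g i)) F \<le> l2norm f + l2norm g" if "finite F" for F
  proof -
    have "L2_set (\<lambda>i. cmod (f i + g i)) F \<le> L2_set (\<lambda>i. cmod (f i) + cmod (g i)) F"
      by (intro L2_set_mono norm_triangle_ineq) auto
    also have "\<dots> \<le> L2_set (\<lambda>i. cmod (f i)) F + L2_set (\<lambda>i. cmod (g i)) F"
      by (rule L2_set_triangle_ineq)
    also have "\<dots> \<le> l2norm f + l2norm g"
      using assms that by (intro add_mono L2_set_le_l2norm)
    finally show ?thesis .
  qed
  note bounded = l2_bounded[of "\<lambda>i. f i + g i", OF this]
  show "(\<lambda>i. f i + g i) \<in> l2" "l2norm (\<lambda>i. f i + g i) \<le> l2norm f + l2norm g"
    using bounded by auto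
qed

lemma cmult_l2:
  assumes "f \<in> l2"
  shows "(\<lambda>i. c * f i) \<in> l2"
  using assms by (auto simp: l2_def norm_mult power_mult_distrib intro!: summable_on_cmult_right)

lemma l2norm_cmult: "l2norm (\<lambda>i. c * f i) = cmod c * l2norm f"
  by (simp add: l2norm_def norm_mult power_mult_distrib infsum_cmult_right' real_sqrt_mult)

lemma diff_l2:
  assumes "f \<in> l2" "g \<in> l2"
  shows "(\<lambda>i. f i - g i) \<in> l2" "l2norm (\<lambda>i. f i - g i) \<le> l2norm f + l2norm g"
  using add_l2[OF assms(1) cmult_l2[OF assms(2), of "-1"]] l2norm_cmult[of "-1" g] by simp_all

lemma l2norm_diff_commute: "l2norm (\<lambda>i. f i - g i) = l2norm (\<lambda>i. g i - f i)"
  by (simp add: l2norm_def norm_minus_commute)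

lemma l2norm_diff_triangle:
  assumes "f \<in> l2" "g \<in> l2" "h \<in> l2"
  shows "l2norm (\<lambda>i. f i - h i) \<le> l2norm (\<lambda>i. f i - g i) + l2norm (\<lambda>i. g i - h i)"
  using add_l2(2)[OF diff_l2(1)[OF assms(1,2)] diff_l2(1)[OF assms(2,3)]] by simp

lemma l2norm_triangle_diff:
  assumes "f \<in> l2" "g \<in> l2"
  shows "\<bar>l2norm f - l2norm g\<bar> \<le> l2norm (\<lambda>i. f i - g i)"
  using l2norm_diff_triangle[OF assms zero_l2(1)]
    l2norm_diff_triangle[OF assms(2,1) zero_l2(1)] l2norm_diff_commute[of f g] by simp

lemma l2norm_eq_zero_iff: "f \<in> l2 \<Longrightarrow> l2norm f = 0 \<longleftrightarrow> f = (\<lambda>i. 0)"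
  using norm_le_l2norm[of f] zero_l2(2) by fastforce

text \<open>The Cauchy-Schwarz inequality over finite sets bounds the sums of absolute values
  uniformly, hence gives absolute summability and the same bound in the limit.\<close>

lemma l2ip_summable:
  assumes "f \<in> l2" "g \<in> l2"
  shows "(\<lambda>i. cnj (f i) * g i) summable_on UNIV" "cmod (l2ip f g) \<le> l2norm f * l2norm g"
proof -
  have le: "(\<Sum>i\<in>F. cmod (cnj (f i) * g i)) \<le> l2norm f * l2norm g" if "finite F" for F
  proof -
    have "(\<Sum>i\<in>F. cmod (cnj (f i) * g i)) \<le> L2_set (\<lambda>i. cmod (f i)) F * L2_set (\<lambda>i. cmod (g i)) F"
      using L2_set_mult_ineq[of "\<lambda>i. cmod (f i)" "\<lambda>i. cmod (g i)" F] by (simp add: norm_mult)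
    also have "\<dots> \<le> l2norm f * l2norm g"
      using assms that by (intro mult_mono L2_set_le_l2norm) auto
    finally show ?thesis .
  qed
  then have sm: "(\<lambda>i. cmod (cnj (f i) * g i)) summable_on UNIV"
    by (intro nonneg_bdd_above_summable_on) (auto intro!: bdd_aboveI)
  then show "(\<lambda>i. cnj (f i) * g i) summable_on UNIV"
    by (rule abs_summable_summable)
  have "cmod (l2ip f g) \<le> (\<Sum>\<^sub>\<infinity>i. cmod (cnj (f i) * g i))"
    unfolding l2ip_def using sm by (rule norm_infsum_bound)
  also have "\<dots> \<le> l2norm f * l2norm g"
    using sm le by (intro infsum_le_finite_sums) auto
  finally show "cmod (l2ip f g) \<le> l2norm f * l2norm g" .
qed

lemma l2ip_add_right:
  assumes "f \<in> l2" "g \<in> l2" "h \<in> l2"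
  shows "l2ip f (\<lambda>i. g i + h i) = l2ip f g + l2ip f h"
  using l2ip_summable(1)[OF assms(1,2)] l2ip_summable(1)[OF assms(1,3)]
  by (simp add: l2ip_def distrib_left infsum_add)

lemma l2ip_cmult_right: "l2ip f (\<lambda>i. c * g i) = c * l2ip f g"
  unfolding l2ip_def by (simp add: infsum_cmult_right' mult.left_commute)

lemma cnj_l2ip: "cnj (l2ip f g) = l2ip g f"
  unfolding l2ip_def by (simp flip: infsum_cnj add: mult.commute)

lemma l2ip_diff_right:
  assumes "f \<in> l2" "g \<in> l2" "h \<in> l2"
  shows "l2ip f (\<lambda>i. g i - h i) = l2ip f g - l2ip f h"
  using l2ip_add_right[OF assms(1,2) cmult_l2[OF assms(3), of "-1"]] l2ip_cmult_right[of f "-1" h]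
  by simp

lemma l2ip_self: "l2ip f f = complex_of_real ((l2norm f)\<^sup>2)"
proof -
  have "l2ip f f = (\<Sum>\<^sub>\<infinity>i. complex_of_real ((cmod (f i))\<^sup>2))"
    by (simp only: l2ip_def complex_norm_square mult.commute)
  \<comment> \<open>\<open>Re\<close> inverts the embedding of the reals, so the two families are
    summable together and the equation also covers the default value 0 of
    \<open>infsum\<close>.\<close>
  also have "\<dots> = complex_of_real (\<Sum>\<^sub>\<infinity>i. (cmod (f i))\<^sup>2)"
    by (intro infsum_bounded_linear_strong bounded_linear_of_real
        summable_on_bounded_linear_iff[OF bounded_linear_of_real bounded_linear_Re]) simp
  finally show ?thesis
    by (simp add: l2norm_def infsum_nonneg)
qed

lemma l2_tail:
  assumes "f \<in> l2" "0 < e"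
  obtains F where "finite F" "l2norm (\<lambda>i. if i \<in> F then 0 else f i) < e"
proof -
  let ?h = "\<lambda>i. (cmod (f i))\<^sup>2"
  have sm: "?h summable_on UNIV"
    using assms by (simp add: l2_def)
  \<comment> \<open>The tolerance is squared because the sum is of squared moduli; half of
    \<open>e\<close> leaves room for the strict inequality.\<close>
  then obtain F where F: "finite F" "dist (sum ?h F) (infsum ?h UNIV) \<le> (e / 2)\<^sup>2"
    using infsum_finite_approximation[of ?h UNIV "(e / 2)\<^sup>2"] assms(2) by auto
  have "infsum ?h UNIV = infsum ?h F + infsum ?h (- F)"
    using infsum_Un_disjoint[of ?h F "- F"] sm by (simp add: F(1) summable_on_subset_banach)
  then have "infsum ?h (- F) \<le> (e / 2)\<^sup>2"
    using F by (simp add: dist_real_def)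
  moreover have "(\<Sum>\<^sub>\<infinity>i. (cmod (if i \<in> F then 0 else f i))\<^sup>2) = infsum ?h (- F)"
    by (rule infsum_cong_neutral) auto
  ultimately have "l2norm (\<lambda>i. if i \<in> F then 0 else f i) \<le> e / 2"
    using assms(2) unfolding l2norm_def by (intro real_le_lsqrt) auto
  then show thesis
    using that[OF F(1)] assms(2) by simp
qed

section \<open>Isometries induced by injections\<close>

text \<open>For injective \<open>p\<close> the chosen preimage is the unique one, and on
  \<open>l2\<close> this is the isometry that sends the unit vector at \<open>i\<close> to the one
  at \<open>p i\<close>.\<close>

definition push :: "('i \<Rightarrow> 'j) \<Rightarrow> ('i \<Rightarrow> complex) \<Rightarrow> 'j \<Rightarrow> complex"
  where "push p f j = (if j \<in> range p then f (inv_into UNIV p j) else 0)"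

lemma push_apply [simp]: "inj p \<Longrightarrow> push p f (p i) = f i"
  by (simp add: push_def)

lemma push_off_range: "j \<notin> range p \<Longrightarrow> push p f j = 0"
  by (simp add: push_def)

lemma push_eqI:
  assumes "inj p" "\<And>i. f i = g (p i)" "\<And>j. j \<notin> range p \<Longrightarrow> g j = 0"
  shows "push p f = g"
  using assms by (auto simp: push_def fun_eq_iff)

lemma l2ip_push: "inj p \<Longrightarrow> l2ip (push p f) (push p g) = l2ip f g"
proof -
  assume p: "inj p"
  have "l2ip (push p f) (push p g) = (\<Sum>\<^sub>\<infinity>j\<in>range p. cnj (push p f j) * push p g j)"
    unfolding l2ip_def by (rule infsum_cong_neutral) (auto simp: push_off_range)
  also have "\<dots> = l2ip f g"
    using p by (simp add: infsum_reindex o_def l2ip_def)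
  finally show ?thesis .
qed

lemma l2norm_push: "inj p \<Longrightarrow> l2norm (push p f) = l2norm f"
  using l2ip_push[of p f f] by (simp add: l2ip_self del: of_real_power)

lemma push_l2:
  assumes p: "inj p" and "f \<in> l2"
  shows "push p f \<in> l2"
proof -
  have "((\<lambda>j. (cmod (push p f j))\<^sup>2) \<circ> p) summable_on UNIV"
    using assms by (simp add: l2_def o_def)
  then have "(\<lambda>j. (cmod (push p f j))\<^sup>2) summable_on range p"
    using p by (simp add: summable_on_reindex)
  then show ?thesis
    unfolding l2_def mem_Collect_eq
    by (rule summable_on_cong_neutral[THEN iffD1, rotated -1]) (auto simp: push_off_range)
qed

lemma push_push:
  assumes "inj p" "inj q"
  shows "push p (push q f) = push (p \<circ> q) f"
proof (rule push_eqI[OF assms(1)])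
  fix i
  show "push q f i = push (p \<circ> q) f (p i)"
  proof (cases "i \<in> range q")
    case True
    then obtain k where "i = q k"
      by blast
    then show ?thesis
      using push_apply[of "p \<circ> q" f k] assms by (simp add: inj_compose)
  next
    case False
    then have "p i \<notin> range (p \<circ> q)"
      using assms(1) by (auto dest: injD)
    then show ?thesis
      using False push_off_range[of i q f] push_off_range[of "p i" "p \<circ> q" f] by metis
  qed
qed (auto intro!: push_off_range)

lemma push_ident: "push (\<lambda>i. i) f = f"
  by (rule push_eqI) auto

text \<open>Only the values of the injections on the support of \<open>f\<close> enter, so
  injections that agree on a finite set act alike on functions supported there.\<close>

lemma push_cong_support:
  assumes "inj p" "inj q" "\<And>i. f i \<noteq> 0 \<Longrightarrow> p i = q i"
  shows "push p f = push q f"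
proof (rule push_eqI[OF assms(1)])
  have *: "push q f (p i) = f i" if "f i \<noteq> 0" for i
    using assms(2) assms(3)[OF that] by simp
  have **: "\<exists>i. j = p i \<and> f i \<noteq> 0" if "push q f j \<noteq> 0" for j
    using that assms(2,3) by (metis push_apply push_off_range rangeE)
  show "f i = push q f (p i)" for i
    using * ** assms(1) by (metis injD)
  show "push q f j = 0" if "j \<notin> range p" for j
    using that ** by blast
qed

lemma push_add: "push p (\<lambda>i. f i + g i) = (\<lambda>j. push p f j + push p g j)"
  and push_diff: "push p (\<lambda>i. f i - g i) = (\<lambda>j. push p f j - push p g j)"
  and push_cmult: "push p (\<lambda>i. c * f i) = (\<lambda>j. c * push p f j)"
  by (auto simp: push_def)

text \<open>Pointwise eventual agreement gives strong convergence: on a finitely supported part the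
  pushes eventually coincide, and on the tail, of norm below \<open>e / 2\<close>, both are
  isometric.\<close>

lemma push_tendsto:
  fixes p :: "nat \<Rightarrow> 'i \<Rightarrow> 'j"
  assumes p: "\<And>n. inj (p n)" "inj q" and ev: "\<And>i. \<forall>\<^sub>F n in sequentially. p n i = q i"
    and f: "f \<in> l2"
  shows "(\<lambda>n. l2norm (\<lambda>j. push (p n) f j - push q f j)) \<longlonglongrightarrow> 0"
proof (rule tendstoI)
  fix e :: real
  assume "0 < e"
  then obtain F where F: "finite F" "l2norm (\<lambda>i. if i \<in> F then 0 else f i) < e / 2"
    using l2_tail[OF f, of "e / 2"] by auto
  let ?a = "\<lambda>i. if i \<in> F then f i else 0" and ?b = "\<lambda>i. if i \<in> F then 0 else f i"
  have b: "?b \<in> l2"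
    using f unfolding l2_def by (auto intro: summable_on_comparison_test)
  have split: "push r f = (\<lambda>j. push r ?a j + push r ?b j)" for r :: "'i \<Rightarrow> 'j"
    by (auto simp: push_def)
  have "\<forall>\<^sub>F n in sequentially. \<forall>i\<in>F. p n i = q i"
    using F(1) ev by (simp add: eventually_ball_finite)
  then show "\<forall>\<^sub>F n in sequentially. dist (l2norm (\<lambda>j. push (p n) f j - push q f j)) 0 < e"
  proof eventually_elim
    case (elim n)
    then have "push (p n) ?a = push q ?a"
      using p by (intro push_cong_support) (auto split: if_splits)
    then have "l2norm (\<lambda>j. push (p n) f j - push q f j) = l2norm (\<lambda>j. push (p n) ?b j - push q ?b j)"
      by (simp add: split[of "p n"] split[of q])
    also have " \<dots> \<le> l2norm (push (p n) ?b) + l2norm (push q ?b)"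
      using p b by (intro diff_l2 push_l2)
    also have "\<dots> < e"
      using F p by (simp add: l2norm_push)
    finally show ?case
      by simp
  qed
qed

section \<open>Convergent sections\<close>

text \<open>The estimates use \<open>\<le> e\<close> because, against a supremum norm, this holds
  exactly when it holds in every fibre.\<close>

lemma (in complex_normed_space) complex_banach_spaceI:
  assumes "\<And>\<sigma>. \<lbrakk>\<And>k::nat. \<sigma> k \<in> carrier M;
      \<And>e. 0 < e \<Longrightarrow> \<exists>K. \<forall>k\<ge>K. \<forall>l\<ge>K. N (\<sigma> k \<ominus> \<sigma> l) \<le> e\<rbrakk>
    \<Longrightarrow> \<exists>x\<in>carrier M. \<forall>e>0. \<exists>K. \<forall>k\<ge>K. N (\<sigma> k \<ominus> x) \<le> e"
  shows "complex_banach_space M N"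
proof
  show "metric.mcomplete"
    unfolding metric.mcomplete_def
  proof (intro allI impI)
    fix \<sigma>
    assume C: "metric.MCauchy \<sigma>"
    then have \<sigma>: "\<sigma> k \<in> carrier M" for k
      by (auto simp: metric.MCauchy_def)
    have "\<exists>K. \<forall>k\<ge>K. \<forall>l\<ge>K. N (\<sigma> k \<ominus> \<sigma> l) \<le> e" if "0 < e" for e
      using C that \<sigma> by (auto simp: metric.MCauchy_def norm_dist_def) (meson less_imp_le)
    then obtain x where x: "x \<in> carrier M" "\<And>e. 0 < e \<Longrightarrow> \<exists>K. \<forall>k\<ge>K. N (\<sigma> k \<ominus> x) \<le> e"
      using assms[of \<sigma>] \<sigma> by blast
    have "\<exists>K. \<forall>k\<ge>K. norm_dist M N (\<sigma> k) x < e" if e: "0 < e" for e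
    proof -
      obtain K where K: "\<forall>k\<ge>K. N (\<sigma> k \<ominus> x) \<le> e / 2"
        using x(2)[of "e / 2"] e by auto
      have "norm_dist M N (\<sigma> k) x < e" if "K \<le> k" for k
        using spec[OF K, of k] that e \<sigma> x(1) by (simp add: norm_dist_def)
      then show ?thesis
        by blast
    qed
    then show "\<exists>x. limitin metric.mtopology \<sigma> x sequentially"
      using x(1) \<sigma> by (auto simp: metric.limit_metric_sequentially)
  qed
qed (auto intro: norm_nonneg norm_smult norm_triangle simp: norm_eq_zero_iff)

text \<open>The one-point compactification of the naturals is \<open>nat\<close> itself, with \<open>0\<close> in the role of
  the point at infinity; a continuous function on it is a sequence that converges to its value
  at \<open>0\<close>.\<close>

definition conv_seqs :: "(nat \<Rightarrow> complex) set"
  where "conv_seqs = {b. b \<longlonglongrightarrow> b 0}"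

definition sections :: "(nat \<Rightarrow> 'i \<Rightarrow> complex) set"
  where "sections = {x. (\<forall>n. x n \<in> l2) \<and> (\<lambda>n. l2norm (\<lambda>i. x n i - x 0 i)) \<longlonglongrightarrow> 0}"

lemma sections_l2: "x \<in> sections \<Longrightarrow> x n \<in> l2"
  by (simp add: sections_def)

lemma bdd_above_convergent:
  fixes u :: "nat \<Rightarrow> real"
  shows "u \<longlonglongrightarrow> a \<Longrightarrow> bdd_above (range u)"
  by (intro Bseq_bdd_above convergent_imp_Bseq convergentI)

lemma conv_seqs_bdd: "b \<in> conv_seqs \<Longrightarrow> bdd_above (range (\<lambda>n. cmod (b n)))"
  unfolding conv_seqs_def mem_Collect_eq by (rule bdd_above_convergent, rule tendsto_norm)

lemma sections_l2norm_tendsto: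
  assumes "x \<in> sections"
  shows "(\<lambda>n. l2norm (x n)) \<longlonglongrightarrow> l2norm (x 0)"
proof -
  have "(\<lambda>n. l2norm (x n) - l2norm (x 0)) \<longlonglongrightarrow> 0"
  proof (rule Lim_null_comparison)
    show "\<forall>\<^sub>F n in sequentially. norm (l2norm (x n) - l2norm (x 0)) \<le> l2norm (\<lambda>i. x n i - x 0 i)"
      using assms by (simp add: l2norm_triangle_diff sections_l2)
  qed (use assms in \<open>simp add: sections_def\<close>)
  then show ?thesis
    by (rule LIM_zero_cancel)
qed

lemma sections_bdd: "x \<in> sections \<Longrightarrow> bdd_above (range (\<lambda>n. l2norm (x n)))"
  by (rule bdd_above_convergent) (rule sections_l2norm_tendsto)

lemma sections_coord: "x \<in> sections \<Longrightarrow> (\<lambda>n. x n i) \<in> conv_seqs"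
proof -
  assume x: "x \<in> sections"
  have le: "norm (x n i - x 0 i) \<le> l2norm (\<lambda>i. x n i - x 0 i)" for n
    by (rule norm_le_l2norm) (intro diff_l2 sections_l2 x)
  have "(\<lambda>n. x n i - x 0 i) \<longlonglongrightarrow> 0"
    by (rule Lim_null_comparison[OF always_eventually[OF allI[OF le]]])
      (use x in \<open>simp add: sections_def\<close>)
  then show ?thesis
    unfolding conv_seqs_def by (simp add: LIM_zero_iff)
qed

text \<open>The equation \<open>a = 0\<close> is kept apart so that unevaluated limits produced by
  the rules for sums and products, such as \<open>0 + 0\<close>, can be supplied directly.\<close>

lemma null_comparison:
  fixes u :: "nat \<Rightarrow> 'a::real_normed_vector"
  assumes "g \<longlonglongrightarrow> a" "a = 0" "\<And>n. norm (u n) \<le> g n"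
  shows "u \<longlonglongrightarrow> 0"
  by (rule Lim_null_comparison[of u g]) (use assms in auto)

lemma sections_add:
  assumes "x \<in> sections" "y \<in> sections"
  shows "(\<lambda>n i. x n i + y n i) \<in> sections"
proof -
  have lim: "(\<lambda>n. l2norm (\<lambda>i. x n i - x 0 i) + l2norm (\<lambda>i. y n i - y 0 i)) \<longlonglongrightarrow> 0 + 0"
    using assms by (intro tendsto_add) (simp_all add: sections_def)
  have "l2norm (\<lambda>i. x n i + y n i - (x 0 i + y 0 i))
      \<le> l2norm (\<lambda>i. x n i - x 0 i) + l2norm (\<lambda>i. y n i - y 0 i)" for n
    using add_l2(2)[of "\<lambda>i. x n i - x 0 i" "\<lambda>i. y n i - y 0 i"] assms
    by (simp add: sections_l2 diff_l2 add_diff_add)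
  then have "(\<lambda>n. l2norm (\<lambda>i. x n i + y n i - (x 0 i + y 0 i))) \<longlonglongrightarrow> 0"
    by (intro null_comparison[OF lim]) simp_all
  then show ?thesis
    using assms by (simp add: sections_def add_l2)
qed

lemma sections_mult:
  assumes x: "x \<in> sections" and b: "b \<in> conv_seqs"
  shows "(\<lambda>n i. b n * x n i) \<in> sections"
proof -
  \<comment> \<open>The bound comes from writing the difference of products as
    \<open>b n * (x n i - x 0 i) + (b n - b 0) * x 0 i\<close>.\<close>
  let ?g = "\<lambda>n. cmod (b n) * l2norm (\<lambda>i. x n i - x 0 i) + cmod (b n - b 0) * l2norm (x 0)"
  have lim: "?g \<longlonglongrightarrow> cmod (b 0) * 0 + 0 * l2norm (x 0)"
    using x b unfolding sections_def conv_seqs_def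
    by (intro tendsto_add tendsto_mult tendsto_norm tendsto_const tendsto_norm_zero LIM_zero) simp_all
  have "l2norm (\<lambda>i. b n * x n i - b 0 * x 0 i) \<le> ?g n" for n
  proof -
    have "l2norm (\<lambda>i. b n * x n i - b 0 * x 0 i)
        = l2norm (\<lambda>i. b n * (x n i - x 0 i) + (b n - b 0) * x 0 i)"
      by (simp add: right_diff_distrib left_diff_distrib)
    also have "\<dots> \<le> l2norm (\<lambda>i. b n * (x n i - x 0 i)) + l2norm (\<lambda>i. (b n - b 0) * x 0 i)"
      by (intro add_l2(2) cmult_l2 diff_l2 sections_l2 x)
    also have "\<dots> = ?g n"
      by (simp only: l2norm_cmult)
    finally show ?thesis .
  qed
  then have "(\<lambda>n. l2norm (\<lambda>i. b n * x n i - b 0 * x 0 i)) \<longlonglongrightarrow> 0"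
    by (intro null_comparison[OF lim]) simp_all
  then show ?thesis
    using x by (simp add: sections_def cmult_l2)
qed

lemma const_conv_seqs: "(\<lambda>n. c) \<in> conv_seqs"
  by (simp add: conv_seqs_def)

lemma conv_seqs_closed:
  assumes "a \<in> conv_seqs" "b \<in> conv_seqs"
  shows "(\<lambda>n. a n + b n) \<in> conv_seqs" "(\<lambda>n. a n * b n) \<in> conv_seqs" "(\<lambda>n. c * a n) \<in> conv_seqs"
    "(\<lambda>n. cnj (a n)) \<in> conv_seqs"
  using assms unfolding conv_seqs_def mem_Collect_eq by (auto intro!: tendsto_intros)

lemma const_sections: "f \<in> l2 \<Longrightarrow> (\<lambda>n. f) \<in> sections"
  by (simp add: sections_def zero_l2)

lemma sections_smult: "x \<in> sections \<Longrightarrow> (\<lambda>n i. c * x n i) \<in> sections"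
  using sections_mult[OF _ const_conv_seqs] .

lemma l2ip_conv_seqs:
  assumes x: "x \<in> sections" and y: "y \<in> sections"
  shows "(\<lambda>n. l2ip (x n) (y n)) \<in> conv_seqs"
proof -
  let ?dx = "\<lambda>n i. x n i - x 0 i" and ?dy = "\<lambda>n i. y n i - y 0 i"
  let ?g = "\<lambda>n. l2norm (x n) * l2norm (?dy n) + l2norm (y 0) * l2norm (?dx n)"
  note l2 = sections_l2[OF x] sections_l2[OF y] diff_l2(1)
  have lim: "?g \<longlonglongrightarrow> l2norm (x 0) * 0 + l2norm (y 0) * 0"
    using x y sections_l2norm_tendsto[OF x]
    by (intro tendsto_add tendsto_mult tendsto_const) (simp_all add: sections_def)
  have "cmod (l2ip (x n) (y n) - l2ip (x 0) (y 0)) \<le> ?g n" for n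
  proof -
    \<comment> \<open>The changes of \<open>y\<close> and of \<open>x\<close> are split off in turn;
      the latter is conjugated to bring it into the second, linear argument.\<close>
    have "l2ip (x n) (y n) - l2ip (x 0) (y 0) = l2ip (x n) (?dy n) + cnj (l2ip (y 0) (?dx n))"
      by (simp add: l2ip_diff_right l2 cnj_l2ip)
    also have "cmod \<dots> \<le> ?g n"
      by (intro norm_triangle_mono) (simp_all add: l2ip_summable(2) l2)
    finally show ?thesis .
  qed
  then have "(\<lambda>n. l2ip (x n) (y n) - l2ip (x 0) (y 0)) \<longlonglongrightarrow> 0"
    by (intro null_comparison[OF lim]) simp_all
  then show ?thesis
    unfolding conv_seqs_def mem_Collect_eq by (rule LIM_zero_cancel)
qed

text \<open>The limit is formed coordinatewise. Estimates over finite sets of coordinates pass to it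
  and give closeness uniform in \<open>n\<close>; a uniform limit of convergent sections
  converges.\<close>

lemma sections_complete:
  fixes \<sigma> :: "nat \<Rightarrow> nat \<Rightarrow> 'i \<Rightarrow> complex"
  assumes \<sigma>: "\<And>k. \<sigma> k \<in> sections"
    and cauchy: "\<And>e. 0 < e \<Longrightarrow> \<exists>K. \<forall>k\<ge>K. \<forall>l\<ge>K. \<forall>n. l2norm (\<lambda>i. \<sigma> k n i - \<sigma> l n i) \<le> e"
  shows "\<exists>x\<in>sections. \<forall>e>0. \<exists>K. \<forall>k\<ge>K. \<forall>n. l2norm (\<lambda>i. \<sigma> k n i - x n i) \<le> e"
proof -
  note l2 = sections_l2[OF \<sigma>]
  have "Cauchy (\<lambda>k. \<sigma> k n i)" for n i
  proof (rule CauchyI)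
    fix e :: real
    assume "0 < e"
    then obtain K where K: "\<forall>k\<ge>K. \<forall>l\<ge>K. \<forall>n. l2norm (\<lambda>i. \<sigma> k n i - \<sigma> l n i) \<le> e / 2"
      using cauchy[of "e / 2"] by auto
    have "norm (\<sigma> k n i - \<sigma> l n i) < e" if "K \<le> k" "K \<le> l" for k l
      using norm_le_l2norm[OF diff_l2(1)[OF l2[of k n] l2[of l n]], of i]
        K[rule_format, OF that, of n] \<open>0 < e\<close> by linarith
    then show "\<exists>K. \<forall>k\<ge>K. \<forall>l\<ge>K. norm (\<sigma> k n i - \<sigma> l n i) < e"
      by blast
  qed
  then have "\<exists>z. (\<lambda>k. \<sigma> k n i) \<longlonglongrightarrow> z" for n i
    by (simp add: Cauchy_convergent_iff convergent_def)
  then obtain x where lim: "\<And>n i. (\<lambda>k. \<sigma> k n i) \<longlonglongrightarrow> x n i"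
    by metis
  \<comment> \<open>In a finite sum \<open>l\<close> can tend to infinity termwise;
    \<open>l2_bounded\<close> then returns square summability together with the norm bound.\<close>
  have close: "(\<lambda>i. \<sigma> k n i - x n i) \<in> l2 \<and> l2norm (\<lambda>i. \<sigma> k n i - x n i) \<le> e"
    if K: "\<forall>k\<ge>K. \<forall>l\<ge>K. \<forall>n. l2norm (\<lambda>i. \<sigma> k n i - \<sigma> l n i) \<le> e" and k: "K \<le> k" for e K k n
  proof -
    have "L2_set (\<lambda>i. cmod (\<sigma> k n i - x n i)) F \<le> e" if F: "finite F" for F
    proof (rule LIMSEQ_le_const2)
      show "(\<lambda>l. L2_set (\<lambda>i. cmod (\<sigma> k n i - \<sigma> l n i)) F)
          \<longlonglongrightarrow> L2_set (\<lambda>i. cmod (\<sigma> k n i - x n i)) F"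
        unfolding L2_set_def by (intro tendsto_intros lim)
      have "L2_set (\<lambda>i. cmod (\<sigma> k n i - \<sigma> l n i)) F \<le> e" if "K \<le> l" for l
        using L2_set_le_l2norm[OF diff_l2(1)[OF l2[of k n] l2[of l n]] F]
        K[rule_format, OF k that, of n] by linarith
      then show "\<exists>K. \<forall>l\<ge>K. L2_set (\<lambda>i. cmod (\<sigma> k n i - \<sigma> l n i)) F \<le> e"
        by blast
    qed
    then show ?thesis
      using l2_bounded[of "\<lambda>i. \<sigma> k n i - x n i" e] by simp
  qed
  have x: "x n \<in> l2" for n
  proof -
    obtain K where "\<forall>k\<ge>K. \<forall>l\<ge>K. \<forall>n. l2norm (\<lambda>i. \<sigma> k n i - \<sigma> l n i) \<le> 1"
      using cauchy[of 1] by auto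
    then have "(\<lambda>i. \<sigma> K n i - x n i) \<in> l2"
      using close[of K 1 K n] by simp
    from diff_l2(1)[OF l2 this, of K n] show ?thesis
      by simp
  qed
  have conv: "\<exists>K. \<forall>k\<ge>K. \<forall>n. l2norm (\<lambda>i. \<sigma> k n i - x n i) \<le> e" if e: "0 < e" for e
  proof -
    obtain K where "\<forall>k\<ge>K. \<forall>l\<ge>K. \<forall>n. l2norm (\<lambda>i. \<sigma> k n i - \<sigma> l n i) \<le> e"
      using cauchy[OF e] by auto
    then show ?thesis
      using close[of K e] by (intro exI[of _ K]) simp
  qed
  have "(\<lambda>n. l2norm (\<lambda>i. x n i - x 0 i)) \<longlonglongrightarrow> 0"
  proof (rule LIMSEQ_I)
    fix e :: real
    assume e: "0 < e"
    \<comment> \<open>One \<open>K\<close> serves all \<open>n\<close>, including the point 0 at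
      infinity: one third is spent at \<open>n\<close>, one on the convergence of
      \<open>\<sigma> K\<close>, one at 0.\<close>
    then obtain K where "\<forall>k\<ge>K. \<forall>n. l2norm (\<lambda>i. \<sigma> k n i - x n i) \<le> e / 3"
      using conv[of "e / 3"] by auto
    then have K: "l2norm (\<lambda>i. \<sigma> K n i - x n i) \<le> e / 3" for n
      by simp
    have "(\<lambda>n. l2norm (\<lambda>i. \<sigma> K n i - \<sigma> K 0 i)) \<longlonglongrightarrow> 0"
      using \<sigma> by (simp add: sections_def)
    then have "\<forall>\<^sub>F n in sequentially. l2norm (\<lambda>i. \<sigma> K n i - \<sigma> K 0 i) < e / 3"
      using e by (intro order_tendstoD) auto
    then obtain m where m: "\<And>n. m \<le> n \<Longrightarrow> l2norm (\<lambda>i. \<sigma> K n i - \<sigma> K 0 i) < e / 3"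
      by (auto simp: eventually_sequentially)
    have "l2norm (\<lambda>i. x n i - x 0 i) < e" if "m \<le> n" for n
    proof -
      have "l2norm (\<lambda>i. x n i - x 0 i)
          \<le> l2norm (\<lambda>i. x n i - \<sigma> K n i) + l2norm (\<lambda>i. \<sigma> K n i - x 0 i)"
        by (intro l2norm_diff_triangle x l2)
      also have "l2norm (\<lambda>i. \<sigma> K n i - x 0 i)
          \<le> l2norm (\<lambda>i. \<sigma> K n i - \<sigma> K 0 i) + l2norm (\<lambda>i. \<sigma> K 0 i - x 0 i)"
        by (intro l2norm_diff_triangle x l2)
      finally show ?thesis
        using K[of n] K[of 0] m[OF that] l2norm_diff_commute[of "x n" "\<sigma> K n"] by linarith
    qed
    then show "\<exists>m. \<forall>n\<ge>m. norm (l2norm (\<lambda>i. x n i - x 0 i) - 0) < e"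
      by auto
  qed
  then have "x \<in> sections"
    using x by (simp add: sections_def)
  then show ?thesis
    by (rule bexI[rotated]) (intro allI impI conv)
qed

section \<open>Suprema of bounded real sequences\<close>

lemma SUP_cmult:
  fixes u :: "nat \<Rightarrow> real"
  assumes "bdd_above (range u)" "0 \<le> c"
  shows "(SUP n. c * u n) = c * (SUP n. u n)"
proof -
  have "continuous (at_left (Sup (range u))) (\<lambda>x. c * x)"
    by (intro continuous_intros)
  then show ?thesis
    using continuous_at_Sup_mono[of "\<lambda>x. c * x" "range u"] assms
    by (simp add: image_image mono_def mult_left_mono)
qed

text \<open>The root is continuous and monotone, hence commutes with the supremum. This serves the
  module norm, a root of a supremum of squares, and the C*-identity.\<close>

lemma SUP_sqrt:
  fixes u :: "nat \<Rightarrow> real"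
  assumes "bdd_above (range u)"
  shows "(SUP n. sqrt (u n)) = sqrt (SUP n. u n)"
proof -
  have "continuous (at_left (Sup (range u))) sqrt"
    by (rule continuous_at_imp_continuous_at_within) (rule isCont_real_sqrt)
  then show ?thesis
    using continuous_at_Sup_mono[of sqrt "range u"] assms
    by (simp add: image_image mono_def)
qed

lemma SUP_triangle:
  fixes u v w :: "nat \<Rightarrow> real"
  assumes "bdd_above (range u)" "bdd_above (range v)" "\<And>n. w n \<le> u n + v n"
  shows "(SUP n. w n) \<le> (SUP n. u n) + (SUP n. v n)"
proof (rule cSUP_least)
  fix n
  have "u n \<le> (SUP n. u n)" "v n \<le> (SUP n. v n)"
    using assms(1,2) by (simp_all add: cSUP_upper)
  then show "w n \<le> (SUP n. u n) + (SUP n. v n)"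
    using assms(3)[of n] by linarith
qed simp

lemma SUP_eq_zero_iff:
  fixes u :: "nat \<Rightarrow> real"
  assumes "bdd_above (range u)" "\<And>n. 0 \<le> u n"
  shows "(SUP n. u n) = 0 \<longleftrightarrow> (\<forall>n. u n = 0)"
proof
  assume "(SUP n. u n) = 0"
  then show "\<forall>n. u n = 0"
    using cSUP_upper[OF UNIV_I assms(1)] assms(2) by (simp add: order_antisym)
qed simp

lemma SUP_nonneg:
  fixes u :: "nat \<Rightarrow> real"
  assumes "bdd_above (range u)" "\<And>n. 0 \<le> u n"
  shows "0 \<le> (SUP n. u n)"
  using cSUP_upper[OF _ assms(1), of 0] assms(2)[of 0] by simp

section \<open>The Hilbert module of convergent sections\<close>

text \<open>The commutative C*-algebra of continuous functions on the one-point compactification of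
  the naturals.\<close>

definition conv_algebra :: "(nat \<Rightarrow> complex) cstar"
  where "conv_algebra = \<lparr>carrier = conv_seqs, mult = (\<lambda>a b n. a n * b n), one = (\<lambda>n. 1),
    zero = (\<lambda>n. 0), add = (\<lambda>a b n. a n + b n), smult = (\<lambda>c a n. c * a n),
    adj = (\<lambda>a n. cnj (a n)), cnorm = (\<lambda>a. SUP n. cmod (a n))\<rparr>"

definition section_module :: "(nat \<Rightarrow> 'i \<Rightarrow> complex, nat \<Rightarrow> complex) hmodule"
  where "section_module = \<lparr>carrier = sections, mult = (\<lambda>x y n i. 0), one = (\<lambda>n i. 0),
    zero = (\<lambda>n i. 0), add = (\<lambda>x y n i. x n i + y n i), smult = (\<lambda>c x n i. c * x n i),
    ract = (\<lambda>x b n i. b n * x n i), ip = (\<lambda>x y n. l2ip (x n) (y n))\<rparr>"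

lemma conv_algebra_simps [simp]:
  "carrier conv_algebra = conv_seqs" "a \<otimes>\<^bsub>conv_algebra\<^esub> b = (\<lambda>n. a n * b n)"
  "\<zero>\<^bsub>conv_algebra\<^esub> = (\<lambda>n. 0)" "a \<oplus>\<^bsub>conv_algebra\<^esub> b = (\<lambda>n. a n + b n)"
  "c \<odot>\<^bsub>conv_algebra\<^esub> a = (\<lambda>n. c * a n)" "adj conv_algebra a = (\<lambda>n. cnj (a n))"
  "cnorm conv_algebra a = (SUP n. cmod (a n))"
  by (simp_all add: conv_algebra_def)

lemma section_module_simps [simp]:
  "carrier section_module = sections" "\<zero>\<^bsub>section_module\<^esub> = (\<lambda>n i. 0)"
  "x \<oplus>\<^bsub>section_module\<^esub> y = (\<lambda>n i. x n i + y n i)"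
  "c \<odot>\<^bsub>section_module\<^esub> x = (\<lambda>n i. c * x n i)"
  "ract section_module x b = (\<lambda>n i. b n * x n i)"
  "ip section_module x y = (\<lambda>n. l2ip (x n) (y n))"
  by (simp_all add: section_module_def)

lemma module_conv_algebra: "Module.module complex_ring conv_algebra"
proof (rule moduleI)
  show "abelian_group conv_algebra"
  proof (rule abelian_groupI)
    fix a
    assume "a \<in> carrier conv_algebra"
    then show "\<exists>b\<in>carrier conv_algebra. b \<oplus>\<^bsub>conv_algebra\<^esub> a = \<zero>\<^bsub>conv_algebra\<^esub>"
      using conv_seqs_closed(3)[of a a "-1"] by (intro bexI[of _ "\<lambda>n. -1 * a n"]) simp_all
  qed (simp_all add: conv_seqs_closed const_conv_seqs algebra_simps)
qed (simp_all add: cring_from_type_algebra conv_seqs_closed algebra_simps)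

lemma abelian_group_section_module: "abelian_group section_module"
proof (rule abelian_groupI)
  fix x :: "nat \<Rightarrow> 'a \<Rightarrow> complex"
  assume "x \<in> carrier section_module"
  then show "\<exists>y\<in>carrier section_module. y \<oplus>\<^bsub>section_module\<^esub> x = \<zero>\<^bsub>section_module\<^esub>"
    using sections_smult[of x "-1"] by (intro bexI[of _ "\<lambda>n i. -1 * x n i"]) simp_all
qed (simp_all add: sections_add const_sections zero_l2 algebra_simps)

lemma module_section_module: "Module.module complex_ring section_module"
  by (rule moduleI) (simp_all add: cring_from_type_algebra abelian_group_section_module
      sections_add sections_smult algebra_simps)

lemma hnorm_section_module:
  assumes "x \<in> sections"
  shows "hnorm conv_algebra section_module x = (SUP n. l2norm (x n))"
proof -
  have "bdd_above (range (\<lambda>n. (l2norm (x n))\<^sup>2))"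
    by (rule bdd_above_convergent) (rule tendsto_power[OF sections_l2norm_tendsto[OF assms]])
  then show ?thesis
    by (simp add: hnorm_def l2ip_self norm_power flip: SUP_sqrt)
qed

lemma normed_conv_algebra: "complex_normed_space conv_algebra (cnorm conv_algebra)"
proof (intro complex_normed_space.intro complex_normed_space_axioms.intro module_conv_algebra)
  fix a b :: "nat \<Rightarrow> complex" and c :: complex
  assume "a \<in> carrier conv_algebra"
  then have a: "bdd_above (range (\<lambda>n. cmod (a n)))"
    by (simp add: conv_seqs_bdd)
  then show "0 \<le> cnorm conv_algebra a"
    by (simp add: SUP_nonneg)
  show "cnorm conv_algebra a = 0 \<longleftrightarrow> a = \<zero>\<^bsub>conv_algebra\<^esub>"
    using SUP_eq_zero_iff[OF a] by (simp add: fun_eq_iff)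
  show "cnorm conv_algebra (c \<odot>\<^bsub>conv_algebra\<^esub> a) = cmod c * cnorm conv_algebra a"
    using SUP_cmult[OF a, of "cmod c"] by (simp add: norm_mult)
  assume "b \<in> carrier conv_algebra"
  then have "bdd_above (range (\<lambda>n. cmod (b n)))"
    by (simp add: conv_seqs_bdd)
  then show "cnorm conv_algebra (a \<oplus>\<^bsub>conv_algebra\<^esub> b) \<le> cnorm conv_algebra a + cnorm conv_algebra b"
    using SUP_triangle[OF a, of "\<lambda>n. cmod (b n)" "\<lambda>n. cmod (a n + b n)"]
    by (simp add: norm_triangle_ineq)
qed

lemma normed_section_module:
  "complex_normed_space section_module (hnorm conv_algebra section_module)"
proof (intro complex_normed_space.intro complex_normed_space_axioms.intro module_section_module)
  fix x y :: "nat \<Rightarrow> 'a \<Rightarrow> complex" and c :: complex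
  assume "x \<in> carrier section_module"
  then have x: "x \<in> sections"
    by simp
  note bdd = sections_bdd[OF x]
  show "0 \<le> hnorm conv_algebra section_module x"
    by (simp add: hnorm_section_module x SUP_nonneg bdd)
  show "hnorm conv_algebra section_module x = 0 \<longleftrightarrow> x = \<zero>\<^bsub>section_module\<^esub>"
    using SUP_eq_zero_iff[OF bdd]
    by (simp add: hnorm_section_module x l2norm_eq_zero_iff sections_l2 fun_eq_iff)
  show "hnorm conv_algebra section_module (c \<odot>\<^bsub>section_module\<^esub> x)
      = cmod c * hnorm conv_algebra section_module x"
    using SUP_cmult[OF bdd, of "cmod c"]
    by (simp add: hnorm_section_module x sections_smult l2norm_cmult)
  assume "y \<in> carrier section_module"
  then have y: "y \<in> sections"
    by simp
  show "hnorm conv_algebra section_module (x \<oplus>\<^bsub>section_module\<^esub> y)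
      \<le> hnorm conv_algebra section_module x + hnorm conv_algebra section_module y"
    using SUP_triangle[OF bdd sections_bdd[OF y]] add_l2(2)[OF sections_l2[OF x] sections_l2[OF y]]
    by (simp add: hnorm_section_module x y sections_add)
qed

lemma minus_conv_algebra:
  assumes "a \<in> conv_seqs" "b \<in> conv_seqs"
  shows "a \<ominus>\<^bsub>conv_algebra\<^esub> b = (\<lambda>n. a n - b n)"
proof -
  interpret complex_normed_space conv_algebra "cnorm conv_algebra"
    by (rule normed_conv_algebra)
  show ?thesis
    using assms by (simp add: minus_eq_smult)
qed

lemma minus_section_module:
  assumes "x \<in> sections" "y \<in> sections"
  shows "x \<ominus>\<^bsub>section_module\<^esub> y = (\<lambda>n i. x n i - y n i)"
proof -
  interpret complex_normed_space section_module "hnorm conv_algebra section_module"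
    by (rule normed_section_module)
  show ?thesis
    using assms by (simp add: minus_eq_smult)
qed

lemma sections_diff: "\<lbrakk>x \<in> sections; y \<in> sections\<rbrakk> \<Longrightarrow> (\<lambda>n i. x n i - y n i) \<in> sections"
  using sections_add[OF _ sections_smult[of y "-1"], of x] by simp

text \<open>A supremum is at most \<open>c\<close> exactly when all its terms are. Cauchy and
  convergence conditions in the module thus become the uniform ones of
  \<open>sections_complete\<close>.\<close>

lemma hnorm_diff_le_iff:
  assumes "x \<in> sections" "y \<in> sections"
  shows "hnorm conv_algebra section_module (x \<ominus>\<^bsub>section_module\<^esub> y) \<le> c
    \<longleftrightarrow> (\<forall>n. l2norm (\<lambda>i. x n i - y n i) \<le> c)"
  using cSUP_le_iff[OF UNIV_not_empty sections_bdd[OF sections_diff[OF assms]]] assms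
  by (simp add: minus_section_module hnorm_section_module sections_diff)

lemma banach_section_module:
  "complex_banach_space section_module (hnorm conv_algebra section_module)"
proof (rule complex_normed_space.complex_banach_spaceI[OF normed_section_module])
  fix \<sigma> :: "nat \<Rightarrow> nat \<Rightarrow> 'a \<Rightarrow> complex"
  assume "\<And>k. \<sigma> k \<in> carrier section_module"
  then have \<sigma>: "\<sigma> k \<in> sections" for k
    by simp
  assume "\<And>e. 0 < e \<Longrightarrow>
    \<exists>K. \<forall>k\<ge>K. \<forall>l\<ge>K. hnorm conv_algebra section_module (\<sigma> k \<ominus>\<^bsub>section_module\<^esub> \<sigma> l) \<le> e"
  then have cauchy: "\<exists>K. \<forall>k\<ge>K. \<forall>l\<ge>K. \<forall>n. l2norm (\<lambda>i. \<sigma> k n i - \<sigma> l n i) \<le> e" if "0 < e" for e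
    using that by (simp add: hnorm_diff_le_iff \<sigma>)
  obtain x where "x \<in> sections"
    and "\<forall>e>0. \<exists>K. \<forall>k\<ge>K. \<forall>n. l2norm (\<lambda>i. \<sigma> k n i - x n i) \<le> e"
    using sections_complete[of \<sigma>, OF \<sigma> cauchy] by blast
  then show "\<exists>x\<in>carrier section_module. \<forall>e>0. \<exists>K. \<forall>k\<ge>K.
      hnorm conv_algebra section_module (\<sigma> k \<ominus>\<^bsub>section_module\<^esub> x) \<le> e"
    by (intro bexI[of _ x]) (simp_all add: hnorm_diff_le_iff \<sigma>)
qed

text \<open>Completeness of the algebra is the case of one-dimensional fibres.\<close>

lemma l2_unit: "(f :: unit \<Rightarrow> complex) \<in> l2" "l2norm f = cmod (f ())"
  by (simp_all add: l2_def l2norm_def UNIV_unit)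

lemma conv_seqs_iff_sections: "b \<in> conv_seqs \<longleftrightarrow> (\<lambda>n (_::unit). b n) \<in> sections"
  unfolding conv_seqs_def sections_def
  by (simp add: l2_unit tendsto_norm_zero_iff LIM_zero_iff)

lemma cnorm_diff_le_iff:
  assumes "a \<in> conv_seqs" "b \<in> conv_seqs"
  shows "cnorm conv_algebra (a \<ominus>\<^bsub>conv_algebra\<^esub> b) \<le> c \<longleftrightarrow> (\<forall>n. cmod (a n - b n) \<le> c)"
proof -
  have "(\<lambda>n. a n - b n) \<in> conv_seqs"
    using assms unfolding conv_seqs_def mem_Collect_eq by (intro tendsto_diff)
  then show ?thesis
    using cSUP_le_iff[OF UNIV_not_empty conv_seqs_bdd] assms by (simp add: minus_conv_algebra)
qed

lemma banach_conv_algebra: "complex_banach_space conv_algebra (cnorm conv_algebra)"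
proof (rule complex_normed_space.complex_banach_spaceI[OF normed_conv_algebra])
  fix \<sigma> :: "nat \<Rightarrow> nat \<Rightarrow> complex"
  let ?\<tau> = "\<lambda>k n (_::unit). \<sigma> k n"
  assume "\<And>k. \<sigma> k \<in> carrier conv_algebra"
  then have \<sigma>: "\<sigma> k \<in> conv_seqs" for k
    by simp
  then have \<tau>: "?\<tau> k \<in> sections" for k
    by (simp flip: conv_seqs_iff_sections)
  assume "\<And>e. 0 < e \<Longrightarrow>
    \<exists>K. \<forall>k\<ge>K. \<forall>l\<ge>K. cnorm conv_algebra (\<sigma> k \<ominus>\<^bsub>conv_algebra\<^esub> \<sigma> l) \<le> e"
  then have cauchy: "\<exists>K. \<forall>k\<ge>K. \<forall>l\<ge>K. \<forall>n. l2norm (\<lambda>i. ?\<tau> k n i - ?\<tau> l n i) \<le> e" if "0 < e" for e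
    using that by (simp only: cnorm_diff_le_iff \<sigma> l2_unit)
  obtain x where x: "x \<in> sections"
    and lim: "\<forall>e>0. \<exists>K. \<forall>k\<ge>K. \<forall>n. l2norm (\<lambda>i. ?\<tau> k n i - x n i) \<le> e"
    using sections_complete[of ?\<tau>, OF \<tau> cauchy] by blast
  from x have "(\<lambda>n. x n ()) \<in> conv_seqs"
    by (rule sections_coord)
  then show "\<exists>b\<in>carrier conv_algebra. \<forall>e>0. \<exists>K. \<forall>k\<ge>K.
      cnorm conv_algebra (\<sigma> k \<ominus>\<^bsub>conv_algebra\<^esub> b) \<le> e"
    using lim
    by (intro bexI[of _ "\<lambda>n. x n ()"])
      (auto simp only: cnorm_diff_le_iff \<sigma> l2_unit conv_algebra_simps(1))
qed

lemma cstar_conv_algebra: "cstar_algebra conv_algebra"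
proof (intro cstar_algebra.intro cstar_algebra_axioms.intro banach_conv_algebra)
  fix a b :: "nat \<Rightarrow> complex"
  assume "a \<in> carrier conv_algebra"
  then have a: "bdd_above (range (\<lambda>n. cmod (a n)))" and conv: "a \<longlonglongrightarrow> a 0"
    by (simp_all add: conv_seqs_bdd) (simp add: conv_seqs_def)
  have "bdd_above (range (\<lambda>n. (cmod (a n))\<^sup>2))"
    by (rule bdd_above_convergent) (rule tendsto_power[OF tendsto_norm[OF conv]])
  \<comment> \<open>The supremum of the moduli is the root of the supremum of their squares;
    squaring gives the C*-identity.\<close>
  from SUP_sqrt[OF this] SUP_nonneg[OF this]
  show "cnorm conv_algebra (adj conv_algebra a \<otimes>\<^bsub>conv_algebra\<^esub> a) = (cnorm conv_algebra a)\<^sup>2"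
    by (simp add: norm_mult power2_eq_square)
  assume "b \<in> carrier conv_algebra"
  then have b: "bdd_above (range (\<lambda>n. cmod (b n)))"
    by (simp add: conv_seqs_bdd)
  have "cmod (a n) * cmod (b n) \<le> (SUP n. cmod (a n)) * (SUP n. cmod (b n))" for n
    using a b by (intro mult_mono cSUP_upper SUP_nonneg) simp_all
  then show "cnorm conv_algebra (a \<otimes>\<^bsub>conv_algebra\<^esub> b) \<le> cnorm conv_algebra a * cnorm conv_algebra b"
    by (simp add: norm_mult cSUP_least)
qed (simp_all add: conv_seqs_closed algebra_simps)

lemma hilbert_section_module: "hilbert_module conv_algebra section_module"
proof (intro hilbert_module.intro hilbert_module_axioms.intro cstar_conv_algebra banach_section_module)
  fix x :: "nat \<Rightarrow> 'a \<Rightarrow> complex"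
  assume "x \<in> carrier section_module"
  then have x: "x \<in> sections"
    by simp
  show "positive_in conv_algebra (ip section_module x x)"
    unfolding positive_in_def
  \<comment> \<open>The fibre norms form a convergent real sequence, a self-adjoint square root of
    the inner product inside the algebra.\<close>
  proof (rule bexI[of _ "\<lambda>n. complex_of_real (l2norm (x n))"])
    show "(\<lambda>n. complex_of_real (l2norm (x n))) \<in> carrier conv_algebra"
      using sections_l2norm_tendsto[OF x] by (simp add: conv_seqs_def tendsto_of_real)
  qed (simp add: l2ip_self power2_eq_square)
  assume "ip section_module x x = \<zero>\<^bsub>conv_algebra\<^esub>"
  then show "x = \<zero>\<^bsub>section_module\<^esub>"
    using l2norm_eq_zero_iff[OF sections_l2[OF x]] by (simp add: l2ip_self fun_eq_iff)
qed (simp_all add: sections_mult l2ip_conv_seqs l2ip_add_right l2ip_cmult_right sections_l2 cnj_l2ip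
    algebra_simps)

section \<open>Flows converging to a shift\<close>

text \<open>For \<open>n > 0\<close> this is translation on the reals with the interval \<open>[-n, 0)\<close> cut out, so it is
  bijective; as \<open>n\<close> grows the incoming half line disappears at infinity, and only the shift of
  the nonnegative half line is left at \<open>n = 0\<close>.\<close>

definition flow :: "nat \<Rightarrow> real \<Rightarrow> real \<Rightarrow> real"
  where "flow n t r =
    (if 0 \<le> r then r + t
     else if n = 0 \<or> - real n \<le> r then r
     else if r + t < - real n then r + t
     else r + t + real n)"

text \<open>A moving point crosses the cut interval at most once, so the jump by \<open>n\<close> is
  counted once on either side.\<close>

lemma flow_flow: "\<lbrakk>0 \<le> t; 0 \<le> u\<rbrakk> \<Longrightarrow> flow n t (flow n u r) = flow n (t + u) r"
  by (auto simp: flow_def)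

lemma flow_zero: "flow n 0 = (\<lambda>r. r)"
  by (auto simp: flow_def)

text \<open>For \<open>n > 0\<close> the four branches have disjoint images: from \<open>t\<close>
  upwards, \<open>[-n, 0)\<close>, below \<open>-n\<close>, and \<open>[0, t)\<close>. For
  \<open>n = 0\<close> only the half lines from \<open>t\<close> upwards and below 0 occur.\<close>

lemma inj_flow: "0 \<le> t \<Longrightarrow> inj (flow n t)"
  by (rule injI) (auto simp: flow_def split: if_splits)

lemma flow_eventually: "\<forall>\<^sub>F n in sequentially. flow n t r = flow 0 t r"
proof -
  \<comment> \<open>Once \<open>n\<close> reaches \<open>- r\<close>, a negative \<open>r\<close>
    lies in the cut interval and stays fixed, as it does under \<open>flow 0\<close>.\<close>
  obtain m :: nat where "- r \<le> real m"
    using real_arch_simple by blast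
  then have "flow n t r = flow 0 t r" if "m \<le> n" for n
    using that by (auto simp: flow_def)
  then show ?thesis
    by (auto simp: eventually_sequentially)
qed

definition flow_semigroup :: "real \<Rightarrow> (nat \<Rightarrow> real \<Rightarrow> complex) \<Rightarrow> nat \<Rightarrow> real \<Rightarrow> complex"
  where "flow_semigroup t x n = push (flow n t) (x n)"

lemma flow_semigroup_sections:
  assumes t: "0 \<le> t" and x: "x \<in> sections"
  shows "flow_semigroup t x \<in> sections"
proof -
  let ?p = "\<lambda>n. push (flow n t)"
  \<comment> \<open>The first term is the change of the section under the common isometry over
    \<open>n\<close>, the second the strong convergence of the isometries at the fixed vector
    \<open>x 0\<close>.\<close>
  let ?g = "\<lambda>n. l2norm (\<lambda>r. x n r - x 0 r) + l2norm (\<lambda>r. ?p n (x 0) r - ?p 0 (x 0) r)"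
  note l2 = sections_l2[OF x] push_l2[OF inj_flow[OF t]]
  have "(\<lambda>n. l2norm (\<lambda>r. ?p n (x 0) r - ?p 0 (x 0) r)) \<longlonglongrightarrow> 0"
    by (intro push_tendsto inj_flow t flow_eventually l2)
  then have lim: "?g \<longlonglongrightarrow> 0 + 0"
    using x by (intro tendsto_add) (simp_all add: sections_def)
  have le: "l2norm (\<lambda>r. ?p n (x n) r - ?p 0 (x 0) r) \<le> ?g n" for n
  proof -
    have "l2norm (\<lambda>r. ?p n (x n) r - ?p 0 (x 0) r)
        \<le> l2norm (\<lambda>r. ?p n (x n) r - ?p n (x 0) r) + l2norm (\<lambda>r. ?p n (x 0) r - ?p 0 (x 0) r)"
      by (intro l2norm_diff_triangle l2)
    also have "(\<lambda>r. ?p n (x n) r - ?p n (x 0) r) = ?p n (\<lambda>r. x n r - x 0 r)"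
      by (simp only: push_diff)
    also have "l2norm \<dots> = l2norm (\<lambda>r. x n r - x 0 r)"
      by (rule l2norm_push[OF inj_flow[OF t]])
    finally show ?thesis .
  qed
  have "(\<lambda>n. l2norm (\<lambda>r. ?p n (x n) r - ?p 0 (x 0) r)) \<longlonglongrightarrow> 0"
    by (rule null_comparison[OF lim]) (use le in simp_all)
  then show ?thesis
    by (simp add: sections_def flow_semigroup_def l2)
qed

lemma isometry_flow_semigroup: "isometry_semigroup section_module flow_semigroup"
proof -
  have "isometry section_module (flow_semigroup t)" if "0 \<le> t" for t
    using that unfolding isometry_def linear_map_def
    by (simp add: flow_semigroup_sections flow_semigroup_def fun_eq_iff push_add push_cmult
        l2ip_push inj_flow)
  moreover have "flow_semigroup t (flow_semigroup u x) = flow_semigroup (t + u) x"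
    if "0 \<le> t" "0 \<le> u" for t u x
    using that by (simp add: flow_semigroup_def fun_eq_iff push_push inj_flow o_def flow_flow)
  moreover have "flow_semigroup 0 x = x" for x
    by (simp add: flow_semigroup_def fun_eq_iff flow_zero push_ident)
  ultimately show ?thesis
    by (simp add: isometry_semigroup_def linear_semigroup_def isometry_def)
qed

section \<open>Sections supported at one point, and coordinate 0 at infinity\<close>

definition single :: "'i \<Rightarrow> 'i \<Rightarrow> complex"
  where "single i j = (if j = i then 1 else 0)"

lemma single_l2: "single i \<in> l2"
proof -
  have "(\<lambda>j. (cmod (single i j))\<^sup>2) summable_on {i}"
    by simp
  then show ?thesis
    unfolding l2_def mem_Collect_eq
    by (rule summable_on_cong_neutral[THEN iffD1, rotated -1]) (auto simp: single_def)
qed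

lemma l2ip_single: "l2ip (single i) f = f i"
proof -
  have "l2ip (single i) f = (\<Sum>\<^sub>\<infinity>j\<in>{i}. cnj (single i j) * f j)"
    unfolding l2ip_def by (rule infsum_cong_neutral) (auto simp: single_def)
  then show ?thesis
    by (simp add: single_def)
qed

lemma push_single: "inj p \<Longrightarrow> push p (single i) = single (p i)"
  by (rule push_eqI) (auto simp: single_def dest: injD)

definition fibre_single :: "nat \<Rightarrow> 'i \<Rightarrow> nat \<Rightarrow> 'i \<Rightarrow> complex"
  where "fibre_single n i m = (if m = n then single i else (\<lambda>j. 0))"

text \<open>Points \<open>n > 0\<close> are isolated in the compactification: beyond
  \<open>n\<close> the section agrees with its value zero at infinity.\<close>

lemma fibre_single_sections:
  assumes "0 < n"
  shows "fibre_single n i \<in> sections"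
proof -
  have "\<forall>\<^sub>F m in sequentially. l2norm (\<lambda>j. fibre_single n i m j - fibre_single n i 0 j) = 0"
    using eventually_gt_at_top[of n]
    by eventually_elim (use assms in \<open>simp add: fibre_single_def zero_l2\<close>)
  then show ?thesis
    by (simp add: sections_def fibre_single_def single_l2 zero_l2 tendsto_eventually)
qed

lemma flow_semigroup_fibre_single:
  assumes "0 \<le> t"
  shows "flow_semigroup t (fibre_single n r) = fibre_single n (flow n t r)"
proof
  fix m
  have "push (flow m t) (\<lambda>r. 0) = (\<lambda>r. 0 :: complex)"
    by (simp add: push_def fun_eq_iff)
  then show "flow_semigroup t (fibre_single n r) m = fibre_single n (flow n t r) m"
    using assms by (simp add: flow_semigroup_def fibre_single_def push_single inj_flow)
qed

lemma fibre_single_unitary_part: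
  assumes "0 < n"
  shows "fibre_single n 0 \<in> unitary_part section_module flow_semigroup"
  unfolding unitary_part_def
proof
  fix t :: real
  assume "t \<in> {0..}"
  then have t: "0 \<le> t"
    by simp
  \<comment> \<open>The point \<open>- t - n\<close> reaches the edge \<open>- n\<close> at time
    \<open>t\<close> and is carried over the cut to 0. At \<open>t = 0\<close> it would lie in the
    cut and stay fixed, so there 0 itself is taken.\<close>
  let ?r = "if t = 0 then 0 else - t - real n"
  have "flow n t ?r = 0"
    using t assms by (simp add: flow_def)
  then have eq: "fibre_single n 0 = flow_semigroup t (fibre_single n ?r)"
    by (simp add: flow_semigroup_fibre_single t)
  show "fibre_single n 0 \<in> flow_semigroup t ` carrier section_module"
    by (rule image_eqI[where f = "flow_semigroup t", OF eq])
      (simp only: section_module_simps fibre_single_sections[OF assms])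
qed

lemma unitary_part_vanishes:
  assumes "x \<in> unitary_part section_module flow_semigroup"
  shows "x 0 0 = 0"
proof -
  have "x \<in> flow_semigroup 1 ` carrier section_module"
    using assms by (simp add: unitary_part_def)
  then obtain y where "x = flow_semigroup 1 y"
    by blast
  \<comment> \<open>Over infinity, nonnegative points move to at least 1 and negative points stay
    negative.\<close>
  moreover have "0 \<notin> range (flow 0 1)"
    by (auto simp: flow_def)
  ultimately show ?thesis
    by (simp add: flow_semigroup_def push_off_range)
qed

text \<open>Testing against sections supported at a finite point kills coordinate 0 over every
  \<open>n > 0\<close>; continuity of the coordinate carries this to infinity.\<close>

lemma perp_unitary_part_vanishes:
  assumes "x \<in> perp conv_algebra section_module (unitary_part section_module flow_semigroup)"
  shows "x 0 0 = 0"
proof -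
  have x: "x \<in> sections"
    using assms by (simp add: perp_def)
  have "x n 0 = 0" if "0 < n" for n
  proof -
    have "ip section_module (fibre_single n 0) x = \<zero>\<^bsub>conv_algebra\<^esub>"
      using assms fibre_single_unitary_part[OF that] by (simp add: perp_def)
    then have "l2ip (fibre_single n 0 n) (x n) = 0"
      by (simp add: fun_eq_iff)
    then show ?thesis
      by (simp add: fibre_single_def l2ip_single)
  qed
  then have "\<forall>\<^sub>F n in sequentially. x n 0 = 0"
    by (rule eventually_mono[OF eventually_gt_at_top])
  then have "(\<lambda>n. x n 0) \<longlonglongrightarrow> 0"
    by (rule tendsto_eventually)
  moreover have "(\<lambda>n. x n 0) \<longlonglongrightarrow> x 0 0"
    using sections_coord[OF x] by (simp add: conv_seqs_def)
  ultimately show ?thesis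
    using LIMSEQ_unique by blast
qed

text \<open>Coordinate 0 over infinity vanishes on both summands but is 1 on the constant section
  \<open>single 0\<close>.\<close>

lemma unitary_part_not_complemented:
  fixes E :: "(nat \<Rightarrow> real \<Rightarrow> complex, nat \<Rightarrow> complex) hmodule"
  defines "E \<equiv> section_module"
  shows "unitary_part E flow_semigroup <+>\<^bsub>E\<^esub> perp conv_algebra E (unitary_part E flow_semigroup)
    \<noteq> carrier E"
proof
  assume *: "unitary_part E flow_semigroup <+>\<^bsub>E\<^esub>
    perp conv_algebra E (unitary_part E flow_semigroup) = carrier E"
  have "(\<lambda>n. single 0) \<in> carrier E"
    by (simp add: E_def const_sections single_l2)
  with * obtain x y where "x \<in> unitary_part E flow_semigroup"
    and "y \<in> perp conv_algebra E (unitary_part E flow_semigroup)"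
    and eq: "(\<lambda>n. single 0) = x \<oplus>\<^bsub>E\<^esub> y"
    unfolding set_add_def' by blast
  then have "single (0::real) 0 = 0"
    using unitary_part_vanishes[of x] perp_unitary_part_vanishes[of y] fun_cong[OF fun_cong[OF eq], of 0 0]
    by (simp add: E_def)
  then show False
    by (simp add: single_def)
qed

theorem proposition2p2:
  shows
    "(\<forall>(B :: 'b cstar) (E :: ('e, 'b) hmodule) (s :: real \<Rightarrow> 'e \<Rightarrow> 'e).
        hilbert_module B E \<and> isometry_semigroup E s \<longrightarrow>
          (let Eu = unitary_part E s;
               P = (\<lambda>F. closed_submodule B E F \<and> completely_reducing B E F s \<and>
                        reduces_to_unitaries E F s)
           in P Eu \<and>
              (\<forall>F. (P F \<and> (\<forall>G. P G \<and> F \<subseteq> G \<longrightarrow> G = F)) \<longleftrightarrow> F = Eu) \<and>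
              (\<forall>E'. closed_submodule B E E' \<and> reduces_to_unitaries E E' s \<longrightarrow> E' \<subseteq> Eu) \<and>
              reduces_to_completely_nonunitary E (perp B E Eu) s))
     \<and>
     (\<exists>(B :: (nat \<Rightarrow> complex) cstar)
        (E :: (nat \<Rightarrow> real \<Rightarrow> complex, nat \<Rightarrow> complex) hmodule)
        (s :: real \<Rightarrow> (nat \<Rightarrow> real \<Rightarrow> complex) \<Rightarrow> (nat \<Rightarrow> real \<Rightarrow> complex)).
        hilbert_module B E \<and> isometry_semigroup E s \<and>
        unitary_part E s <+>\<^bsub>E\<^esub> perp B E (unitary_part E s) \<noteq> carrier E)"
proof (intro conjI allI impI)
  fix B :: "'b cstar" and E :: "('e, 'b) hmodule" and s :: "real \<Rightarrow> 'e \<Rightarrow> 'e"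
  assume "hilbert_module B E \<and> isometry_semigroup E s"
  then interpret isometry_semigroup_on B E s
    by (simp add: isometry_semigroup_on_def isometry_semigroup_on_axioms_def)
  note u = closed_submodule_unitary_part unitary_part_decomposition
  show "let Eu = unitary_part E s;
             P = (\<lambda>F. closed_submodule B E F \<and> completely_reducing B E F s \<and>
                      reduces_to_unitaries E F s)
         in P Eu \<and>
            (\<forall>F. (P F \<and> (\<forall>G. P G \<and> F \<subseteq> G \<longrightarrow> G = F)) \<longleftrightarrow> F = Eu) \<and>
            (\<forall>E'. closed_submodule B E E' \<and> reduces_to_unitaries E E' s \<longrightarrow> E' \<subseteq> Eu) \<and>
            reduces_to_completely_nonunitary E (perp B E Eu) s"
    \<comment> \<open>Every competitor lies in the unitary part, which is itself a competitor, so a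
      maximal one must coincide with it.\<close>
    unfolding Let_def
    using u(1-3) reduces_to_completely_nonunitary_perp subset_antisym u(4) by metis
next
  show "\<exists>(B :: (nat \<Rightarrow> complex) cstar)
        (E :: (nat \<Rightarrow> real \<Rightarrow> complex, nat \<Rightarrow> complex) hmodule)
        (s :: real \<Rightarrow> (nat \<Rightarrow> real \<Rightarrow> complex) \<Rightarrow> (nat \<Rightarrow> real \<Rightarrow> complex)).
        hilbert_module B E \<and> isometry_semigroup E s \<and>
        unitary_part E s <+>\<^bsub>E\<^esub> perp B E (unitary_part E s) \<noteq> carrier E"
    using hilbert_section_module isometry_flow_semigroup unitary_part_not_complemented by blast
qed

end
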